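(* The two-dimensional Anderson form $\mathfrak a$ defined in the context is almost surely closed, that is, $(\mathcal D(\mathfrak a),\|\cdot\|_{\mathfrak a})$ is a complete space.
   Context: $\mathbb T^2=(\mathbb R/2\pi\mathbb Z)^2$ is the torus with Lebesgue measure $\mathrm dx$ normalized to total mass $1$; functions are real-valued. $\mathcal H^1=\mathcal H^1(\mathbb T^2)$ is the usual Sobolev space. For $\alpha\in\mathbb R$, $\mathcal C^\alpha=\mathcal B^\alpha_{\infty,\infty}$ is the Besov–Hölder space with norm $\sup_{n\ge0}2^{\alpha n}\|\Delta_nu\|_{L^\infty}$, where $(\Delta_n)_{n\ge 0}$ are the Littlewood–Paley projectors. $\langle\cdot,\cdot\rangle$ is the duality bracket extending the $L^2$ inner product. White noise: $\xi=\sum_{k\in\mathbb Z^2}\xi_ke^{ik\cdot x}$, where the $\xi_k$ are centered standard complex Gaussian variables ($\mathbb E|\xi_k|^2=1$, $\xi_0$ real), independent up to the constraint $\xi_{-k}=\overline{\xi_k}$. Thus $\xi$ is the centered Gaussian random distribution with $\mathbb E[\langle\xi,\varphi\rangle\langle\xi,\psi\rangle]=\langle\varphi,\psi\rangle_{L^2}$. The random field $X$ is $X(x)=-\sum_{k\ne0}|k|^{-2}\xi_ke^{ik\cdot x}$, so $\Delta X=\xi-\xi_0$; almost surely $X\in\mathcal C^{1-\kappa}$ for every $\kappa>0$. Let $\xi_\varepsilon=\xi*\rho_\varepsilon$ with $\rho_\varepsilon$ a mollifier and let $X_\varepsilon=X*\rho_\varepsilon$ be the corresponding solution of $\Delta X_\varepsilon=\xi_\varepsilon-\langle\xi_\varepsilon,1\rangle$.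 The Wick square $|\nabla X|^{2\diamond}$ is the random distribution $$|\nabla X|^{2\diamond}=\lim_{\varepsilon\to0}\big(|\nabla X_\varepsilon|^2-\mathbb E[|\nabla X_\varepsilon|^2]\big),$$ the limit being in probability in $\mathcal C^{-2\kappa}(\mathbb T^2)$ for every $\kappa>0$. The Anderson form is $$\mathfrak a(u_1,u_2):=\int_{\mathbb T^2}\nabla v_1\cdot\nabla v_2\,e^{2X}\mathrm dx-\big\langle|\nabla X|^{2\diamond},v_1v_2e^{2X}\big\rangle+\xi_0\int_{\mathbb T^2}v_1v_2\,e^{2X}\mathrm dx,\qquad v_i=e^{-X}u_i,$$ with (random) domain $\mathcal D(\mathfrak a):=e^X\mathcal H^1(\mathbb T^2)=\{e^Xv:v\in\mathcal H^1\}$ and norm $\|u\|_{\mathfrak a}^2:=\|u\|_{L^2}^2+\|e^{-X}u\|_{\mathcal H^1}^2$. *)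

theory Defs
  imports "HOL-Probability.Probability"
begin

section \<open>The torus\<close>

text \<open>
  The torus \<open>(\<real>/2\<pi>\<int>)\<^sup>2\<close> is represented by the fundamental cell \<open>[0,2\<pi>)\<^sup>2\<close> with its uniform
  measure. Elements of \<open>L\<^sup>2\<close> are Borel functions on the plane; only their values on the cell matter,
  and two functions are identified if they agree almost everywhere for \<^term>\<open>torus\<close>.
  Continuous functions on the torus are continuous doubly periodic functions.
\<close>

type_synonym point = "real \<times> real"
type_synonym freq = "int \<times> int"

definition torus :: "point measure" where
  "torus = uniform_measure lborel ({0..<2*pi} \<times> {0..<2*pi})"

definition doubly_periodic :: "(point \<Rightarrow> 'b) \<Rightarrow> bool" where
  "doubly_periodic f \<longleftrightarrow> (\<forall>x y. f (x + 2*pi, y) = f (x, y) \<and> f (x, y + 2*pi) = f (x, y))"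

definition kvec :: "freq \<Rightarrow> point" where
  "kvec k = (of_int (fst k), of_int (snd k))"

definition fcoef :: "(point \<Rightarrow> real) \<Rightarrow> freq \<Rightarrow> complex" where
  "fcoef f k = (\<integral>x. complex_of_real (f x) * cis (- (kvec k \<bullet> x)) \<partial>torus)"

definition L2 :: "(point \<Rightarrow> real) set" where
  "L2 = {f \<in> borel_measurable borel. integrable torus (\<lambda>x. (f x)\<^sup>2)}"

definition L2_norm :: "(point \<Rightarrow> real) \<Rightarrow> real" where
  "L2_norm f = sqrt (\<integral>x. (f x)\<^sup>2 \<partial>torus)"


section \<open>The Sobolev space\<close>

text \<open>
  The condition on the Fourier coefficients is integration by parts against the test functions
  \<open>e\<^sup>-\<^sup>i\<^sup>k\<^sup>\<cdot>\<^sup>x\<close>, i.e. \<open>g\<close> is the gradient of \<open>v\<close> in the sense of distributions.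
\<close>

definition has_weak_gradient :: "(point \<Rightarrow> real) \<Rightarrow> (point \<Rightarrow> point) \<Rightarrow> bool" where
  "has_weak_gradient v g \<longleftrightarrow>
     (\<lambda>x. fst (g x)) \<in> L2 \<and> (\<lambda>x. snd (g x)) \<in> L2 \<and>
     (\<forall>k. fcoef (\<lambda>x. fst (g x)) k = \<i> * of_int (fst k) * fcoef v k \<and>
          fcoef (\<lambda>x. snd (g x)) k = \<i> * of_int (snd k) * fcoef v k)"

definition weak_gradient :: "(point \<Rightarrow> real) \<Rightarrow> point \<Rightarrow> point" where
  "weak_gradient v = (SOME g. has_weak_gradient v g)"

definition H1 :: "(point \<Rightarrow> real) set" where
  "H1 = {v \<in> L2. \<exists>g. has_weak_gradient v g}"

definition H1_norm :: "(point \<Rightarrow> real) \<Rightarrow> real" where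
  "H1_norm v = sqrt ((\<integral>x. (v x)\<^sup>2 \<partial>torus) + (\<integral>x. (norm (weak_gradient v x))\<^sup>2 \<partial>torus))"


section \<open>Distributions, Littlewood--Paley projectors and Besov--Hoelder norms\<close>

text \<open>A distribution on the torus is given by its Fourier coefficients.\<close>

type_synonym tdist = "freq \<Rightarrow> complex"

definition fourier_series :: "tdist \<Rightarrow> point \<Rightarrow> complex" where
  "fourier_series T x = (\<Sum>\<^sub>\<infinity>k. T k * cis (kvec k \<bullet> x))"

text \<open>\<open>F a b\<close> is the partial derivative of order \<open>a\<close> in the first and \<open>b\<close> in the second variable.\<close>

definition smooth_plane :: "(point \<Rightarrow> real) \<Rightarrow> bool" where
  "smooth_plane f \<longleftrightarrow> (\<exists>F :: nat \<Rightarrow> nat \<Rightarrow> point \<Rightarrow> real. F 0 0 = f \<and>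
     (\<forall>a b. continuous_on UNIV (F a b) \<and>
       (\<forall>x y. ((\<lambda>s. F a b (s, y)) has_real_derivative F (Suc a) b (x, y)) (at x) \<and>
              ((\<lambda>s. F a b (x, s)) has_real_derivative F a (Suc b) (x, y)) (at y))))"

definition littlewood_paley :: "(point \<Rightarrow> real) \<Rightarrow> (point \<Rightarrow> real) \<Rightarrow> bool" where
  "littlewood_paley \<theta> \<phi> \<longleftrightarrow>
     smooth_plane \<theta> \<and> smooth_plane \<phi> \<and>
     range \<theta> \<subseteq> {0..1} \<and> range \<phi> \<subseteq> {0..1} \<and>
     (\<forall>z w. norm z = norm w \<longrightarrow> \<theta> z = \<theta> w \<and> \<phi> z = \<phi> w) \<and>
     (\<forall>z. \<theta> z \<noteq> 0 \<longrightarrow> norm z \<le> 4/3) \<and>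
     (\<forall>z. \<phi> z \<noteq> 0 \<longrightarrow> 3/4 \<le> norm z \<and> norm z \<le> 8/3) \<and>
     (\<forall>z. (\<lambda>j::nat. \<phi> (z /\<^sub>R 2^j)) sums (1 - \<theta> z))"

text \<open>The projectors are numbered from 0, block 0 being the low-frequency block \<open>\<theta>(D)\<close>.\<close>

definition lp_symbol :: "(point \<Rightarrow> real) \<Rightarrow> (point \<Rightarrow> real) \<Rightarrow> nat \<Rightarrow> freq \<Rightarrow> real" where
  "lp_symbol \<theta> \<phi> n k = (if n = 0 then \<theta> (kvec k) else \<phi> (kvec k /\<^sub>R 2^(n - 1)))"

definition lp_block ::
    "(point \<Rightarrow> real) \<Rightarrow> (point \<Rightarrow> real) \<Rightarrow> nat \<Rightarrow> tdist \<Rightarrow> point \<Rightarrow> complex" where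
  "lp_block \<theta> \<phi> n T = fourier_series (\<lambda>k. complex_of_real (lp_symbol \<theta> \<phi> n k) * T k)"

definition holder_norm ::
    "(point \<Rightarrow> real) \<Rightarrow> (point \<Rightarrow> real) \<Rightarrow> real \<Rightarrow> tdist \<Rightarrow> ennreal" where
  "holder_norm \<theta> \<phi> \<alpha> T =
     (SUP n. ennreal (2 powr (\<alpha> * real n)) * (SUP x. ennreal (cmod (lp_block \<theta> \<phi> n T x))))"

definition holder_space ::
    "(point \<Rightarrow> real) \<Rightarrow> (point \<Rightarrow> real) \<Rightarrow> real \<Rightarrow> tdist set" where
  "holder_space \<theta> \<phi> \<alpha> = {T. holder_norm \<theta> \<phi> \<alpha> T < \<infinity>}"

text \<open>
  The duality bracket \<open>\<langle>T,g\<rangle>\<close> of a real distribution and a real function: the limit of the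
  \<open>L\<^sup>2\<close> inner products of \<open>g\<close> with the smooth functions \<open>\<Sum>\<^sub>n\<^sub>\<le>\<^sub>N \<Delta>\<^sub>n T\<close>.
\<close>

definition bracket ::
    "(point \<Rightarrow> real) \<Rightarrow> (point \<Rightarrow> real) \<Rightarrow> tdist \<Rightarrow> (point \<Rightarrow> real) \<Rightarrow> real" where
  "bracket \<theta> \<phi> T g = lim (\<lambda>N. \<integral>x. Re (\<Sum>n\<le>N. lp_block \<theta> \<phi> n T x) * g x \<partial>torus)"


section \<open>White noise, the field X and its Wick square\<close>

definition half_lattice :: "freq set" where
  "half_lattice = {k. fst k > 0 \<or> (fst k = 0 \<and> snd k \<ge> 0)}"

text \<open>
  The half lattice contains 0 and exactly one of \<open>k\<close>, \<open>-k\<close> for every nonzero \<open>k\<close>. A standard complex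
  Gaussian has independent real and imaginary parts of variance \<open>1/2\<close>.
\<close>

definition white_noise :: "'w measure \<Rightarrow> (freq \<Rightarrow> 'w \<Rightarrow> complex) \<Rightarrow> bool" where
  "white_noise M \<xi> \<longleftrightarrow>
     prob_space M \<and>
     (\<forall>k. \<xi> k \<in> borel_measurable M) \<and>
     (\<forall>k. AE \<omega> in M. \<xi> (- k) \<omega> = cnj (\<xi> k \<omega>)) \<and>
     prob_space.indep_vars M (\<lambda>_. borel) \<xi> half_lattice \<and>
     distributed M lborel (\<lambda>\<omega>. Re (\<xi> 0 \<omega>)) (normal_density 0 1) \<and>
     (\<forall>k. k \<noteq> 0 \<longrightarrow>
        distributed M lborel (\<lambda>\<omega>. Re (\<xi> k \<omega>)) (normal_density 0 (sqrt (1/2))) \<and>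
        distributed M lborel (\<lambda>\<omega>. Im (\<xi> k \<omega>)) (normal_density 0 (sqrt (1/2))) \<and>
        prob_space.indep_var M borel (\<lambda>\<omega>. Re (\<xi> k \<omega>)) borel (\<lambda>\<omega>. Im (\<xi> k \<omega>)))"

definition X_coef :: "(freq \<Rightarrow> 'w \<Rightarrow> complex) \<Rightarrow> 'w \<Rightarrow> tdist" where
  "X_coef \<xi> \<omega> k = (if k = 0 then 0 else - \<xi> k \<omega> / complex_of_real ((norm (kvec k))\<^sup>2))"

text \<open>
  The Fourier series of \<open>X\<close> does not converge absolutely; the function \<open>X\<close> is the continuous
  representative of the distribution with coefficients \<^term>\<open>X_coef \<xi> \<omega>\<close>.
\<close>

definition X_field :: "(freq \<Rightarrow> 'w \<Rightarrow> complex) \<Rightarrow> 'w \<Rightarrow> point \<Rightarrow> real" where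
  "X_field \<xi> \<omega> =
     (THE f. continuous_on UNIV f \<and> doubly_periodic f \<and> (\<forall>k. fcoef f k = X_coef \<xi> \<omega> k))"

definition mollifier :: "(point \<Rightarrow> real) \<Rightarrow> bool" where
  "mollifier \<rho> \<longleftrightarrow>
     smooth_plane \<rho> \<and> (\<exists>R. \<forall>x. norm x > R \<longrightarrow> \<rho> x = 0) \<and> (\<integral>x. \<rho> x \<partial>lborel) = 1"

text \<open>
  \<open>T * \<rho>\<^sub>\<epsilon>\<close> with \<open>\<rho>\<^sub>\<epsilon>(x) = \<epsilon>\<^sup>-\<^sup>2 \<rho>(x/\<epsilon>)\<close>: averaging \<open>e\<^sup>i\<^sup>k\<^sup>\<cdot>\<^sup>(\<^sup>x\<^sup>-\<^sup>y\<^sup>)\<close> against \<open>\<rho>\<^sub>\<epsilon>(y) dy\<close> over the plane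
  multiplies the \<open>k\<close>-th coefficient by the Fourier transform of \<open>\<rho>\<close> at \<open>\<epsilon>k\<close>.
\<close>

definition mollify :: "(point \<Rightarrow> real) \<Rightarrow> real \<Rightarrow> tdist \<Rightarrow> tdist" where
  "mollify \<rho> \<epsilon> T k =
     T k * (\<integral>y. complex_of_real (\<rho> y) * cis (- ((\<epsilon> *\<^sub>R kvec k) \<bullet> y)) \<partial>lborel)"

definition grad_X_eps ::
    "(freq \<Rightarrow> 'w \<Rightarrow> complex) \<Rightarrow> (point \<Rightarrow> real) \<Rightarrow> real \<Rightarrow> 'w \<Rightarrow> point \<Rightarrow> point" where
  "grad_X_eps \<xi> \<rho> \<epsilon> \<omega> x =
     (Re (fourier_series (\<lambda>k. \<i> * of_int (fst k) * mollify \<rho> \<epsilon> (X_coef \<xi> \<omega>) k) x),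
      Re (fourier_series (\<lambda>k. \<i> * of_int (snd k) * mollify \<rho> \<epsilon> (X_coef \<xi> \<omega>) k) x))"

definition wick_eps ::
    "'w measure \<Rightarrow> (freq \<Rightarrow> 'w \<Rightarrow> complex) \<Rightarrow> (point \<Rightarrow> real) \<Rightarrow> real \<Rightarrow> 'w \<Rightarrow> point \<Rightarrow> real" where
  "wick_eps M \<xi> \<rho> \<epsilon> \<omega> x =
     (norm (grad_X_eps \<xi> \<rho> \<epsilon> \<omega> x))\<^sup>2 - (\<integral>\<omega>'. (norm (grad_X_eps \<xi> \<rho> \<epsilon> \<omega>' x))\<^sup>2 \<partial>M)"

definition is_wick_square ::
    "'w measure \<Rightarrow> (freq \<Rightarrow> 'w \<Rightarrow> complex) \<Rightarrow> (point \<Rightarrow> real) \<Rightarrow>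
     (point \<Rightarrow> real) \<Rightarrow> (point \<Rightarrow> real) \<Rightarrow> ('w \<Rightarrow> tdist) \<Rightarrow> bool" where
  "is_wick_square M \<xi> \<rho> \<theta> \<phi> W \<longleftrightarrow>
     (\<forall>k. (\<lambda>\<omega>. W \<omega> k) \<in> borel_measurable M) \<and>
     (\<forall>\<kappa>>0. (AE \<omega> in M. W \<omega> \<in> holder_space \<theta> \<phi> (- 2 * \<kappa>)) \<and>
       (\<forall>\<delta>>0. ((\<lambda>\<epsilon>. measure M {\<omega> \<in> space M.
            holder_norm \<theta> \<phi> (- 2 * \<kappa>) (\<lambda>k. fcoef (wick_eps M \<xi> \<rho> \<epsilon> \<omega>) k - W \<omega> k) > ennreal \<delta>})
          \<longlongrightarrow> 0) (at_right 0)))"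

text \<open>A limit in probability is determined up to almost sure equality; one version is chosen.\<close>

definition wick_square ::
    "'w measure \<Rightarrow> (freq \<Rightarrow> 'w \<Rightarrow> complex) \<Rightarrow> (point \<Rightarrow> real) \<Rightarrow>
     (point \<Rightarrow> real) \<Rightarrow> (point \<Rightarrow> real) \<Rightarrow> 'w \<Rightarrow> tdist" where
  "wick_square M \<xi> \<rho> \<theta> \<phi> = (SOME W. is_wick_square M \<xi> \<rho> \<theta> \<phi> W)"


section \<open>Closed forms and the Anderson form\<close>

record torus_form =
  form_dom :: "(point \<Rightarrow> real) set"
  form_val :: "(point \<Rightarrow> real) \<Rightarrow> (point \<Rightarrow> real) \<Rightarrow> real"
  form_norm :: "(point \<Rightarrow> real) \<Rightarrow> real"

text \<open>
  \<open>D\<close> with norm \<open>N\<close> is a complete normed space, where functions that agree almost everywhere are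
  identified.
\<close>

definition complete_normed :: "(point \<Rightarrow> real) set \<Rightarrow> ((point \<Rightarrow> real) \<Rightarrow> real) \<Rightarrow> bool" where
  "complete_normed D N \<longleftrightarrow>
     (\<lambda>x. 0) \<in> D \<and>
     (\<forall>u\<in>D. \<forall>w\<in>D. (\<lambda>x. u x + w x) \<in> D) \<and>
     (\<forall>c. \<forall>u\<in>D. (\<lambda>x. c * u x) \<in> D) \<and>
     (\<forall>u\<in>D. 0 \<le> N u \<and> (N u = 0 \<longleftrightarrow> (AE x in torus. u x = 0))) \<and>
     (\<forall>c. \<forall>u\<in>D. N (\<lambda>x. c * u x) = \<bar>c\<bar> * N u) \<and>
     (\<forall>u\<in>D. \<forall>w\<in>D. N (\<lambda>x. u x + w x) \<le> N u + N w) \<and>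
     (\<forall>u :: nat \<Rightarrow> point \<Rightarrow> real.
        (\<forall>n. u n \<in> D) \<and>
        (\<forall>e>0. \<exists>n0. \<forall>m\<ge>n0. \<forall>n\<ge>n0. N (\<lambda>x. u m x - u n x) < e) \<longrightarrow>
        (\<exists>l\<in>D. (\<lambda>n. N (\<lambda>x. u n x - l x)) \<longlonglongrightarrow> 0))"

definition closed_form :: "torus_form \<Rightarrow> bool" where
  "closed_form \<a> \<longleftrightarrow> form_dom \<a> \<subseteq> L2 \<and> complete_normed (form_dom \<a>) (form_norm \<a>)"

definition anderson_val ::
    "'w measure \<Rightarrow> (freq \<Rightarrow> 'w \<Rightarrow> complex) \<Rightarrow> (point \<Rightarrow> real) \<Rightarrow> (point \<Rightarrow> real) \<Rightarrow> (point \<Rightarrow> real) \<Rightarrow>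
     'w \<Rightarrow> (point \<Rightarrow> real) \<Rightarrow> (point \<Rightarrow> real) \<Rightarrow> real" where
  "anderson_val M \<xi> \<rho> \<theta> \<phi> \<omega> u1 u2 =
     (let X = X_field \<xi> \<omega>;
          v1 = (\<lambda>x. exp (- X x) * u1 x);
          v2 = (\<lambda>x. exp (- X x) * u2 x)
      in (\<integral>x. (weak_gradient v1 x \<bullet> weak_gradient v2 x) * exp (2 * X x) \<partial>torus)
         - bracket \<theta> \<phi> (wick_square M \<xi> \<rho> \<theta> \<phi> \<omega>) (\<lambda>x. v1 x * v2 x * exp (2 * X x))
         + Re (\<xi> 0 \<omega>) * (\<integral>x. v1 x * v2 x * exp (2 * X x) \<partial>torus))"

definition anderson_form ::
    "'w measure \<Rightarrow> (freq \<Rightarrow> 'w \<Rightarrow> complex) \<Rightarrow> (point \<Rightarrow> real) \<Rightarrow> (point \<Rightarrow> real) \<Rightarrow> (point \<Rightarrow> real) \<Rightarrow>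
     'w \<Rightarrow> torus_form" where
  "anderson_form M \<xi> \<rho> \<theta> \<phi> \<omega> =
     \<lparr> form_dom = {\<lambda>x. exp (X_field \<xi> \<omega> x) * v x | v. v \<in> H1},
       form_val = anderson_val M \<xi> \<rho> \<theta> \<phi> \<omega>,
       form_norm = (\<lambda>u. sqrt ((L2_norm u)\<^sup>2 + (H1_norm (\<lambda>x. exp (- X_field \<xi> \<omega> x) * u x))\<^sup>2)) \<rparr>"

end

theory Submission
  imports Defs
begin

text \<open>
  Completeness only involves the weight \<open>e\<^sup>X\<close>. If \<open>X\<close> is continuous and periodic, \<open>e\<^sup>X\<close> is bounded
  above and below, so that the norm of \<open>e\<^sup>X v\<close> is equivalent to the \<open>L\<^sup>2\<close> norm of the jet
  \<open>(v, \<nabla>v)\<close>. A Cauchy sequence of jets converges in \<open>L\<^sup>2\<close>, and convergence of the Fourier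
  coefficients shows that the limit is again a jet.

  It remains to see that the continuous representative defining \<open>X\<close> exists almost surely; it is
  unique because an integrable function with vanishing Fourier coefficients is zero. Let \<open>P\<^sub>n\<close> be the
  part of the series of \<open>X\<close> with frequencies of size about \<open>2\<^sup>n\<close> in the half lattice, so that
  \<open>X = \<Sum>\<^sub>n 2 Re P\<^sub>n\<close>. The square \<open>P\<^sub>n\<^sup>2\<close> is a trigonometric polynomial with \<open>O(4\<^sup>n)\<close> coefficients \<open>D\<^sub>m\<close>,
  hence \<open>sup |P\<^sub>n|\<^sup>4 \<le> O(4\<^sup>n) \<Sum>\<^sub>m |D\<^sub>m|\<^sup>2\<close> by Cauchy--Schwarz. In the half lattice the products \<open>\<xi>\<^sub>k \<xi>\<^sub>l\<close>
  of distinct unordered pairs with the same sum are orthogonal, which gives \<open>E \<Sum>\<^sub>m |D\<^sub>m|\<^sup>2 = O(16\<^sup>-\<^sup>n)\<close>. Thus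
  \<open>sup |P\<^sub>n|\<^sup>4\<close> is almost surely \<open>O(2\<^sup>-\<^sup>n)\<close> and the series converges uniformly.
\<close>

section \<open>Vector-valued square-integrable functions\<close>

definition L2_vec :: "'a measure \<Rightarrow> ('a \<Rightarrow> 'b::euclidean_space) set" where
  "L2_vec M = {F \<in> borel_measurable M. integrable M (\<lambda>x. (norm (F x))\<^sup>2)}"

definition L2_vec_norm :: "'a measure \<Rightarrow> ('a \<Rightarrow> 'b::euclidean_space) \<Rightarrow> real" where
  "L2_vec_norm M F = sqrt (\<integral>x. (norm (F x))\<^sup>2 \<partial>M)"

lemma L2_vec_norm_nonneg [simp]: "0 \<le> L2_vec_norm M F"
  by (simp add: L2_vec_norm_def)

lemma L2_vec_norm_power2: "(L2_vec_norm M F)\<^sup>2 = (\<integral>x. (norm (F x))\<^sup>2 \<partial>M)"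
  by (simp add: L2_vec_norm_def)

text \<open>Young's inequality with free weights: after the triangle inequality the two sides differ
  by a square divided by \<open>a * b\<close>. Equal weights give square integrability of sums,
  adapted weights give Minkowski's inequality.\<close>

lemma norm_add_sq_le:
  fixes x y :: "'b::real_normed_vector"
  assumes "0 < a" "0 < b"
  shows "(norm (x + y))\<^sup>2 \<le> (1 + b / a) * (norm x)\<^sup>2 + (1 + a / b) * (norm y)\<^sup>2"
proof -
  have "(norm (x + y))\<^sup>2 \<le> (norm x + norm y)\<^sup>2"
    by (intro power_mono norm_triangle_ineq norm_ge_zero)
  also have "\<dots> \<le> (1 + b / a) * (norm x)\<^sup>2 + (1 + a / b) * (norm y)\<^sup>2"
  proof -
    have "(1 + b / a) * (norm x)\<^sup>2 + (1 + a / b) * (norm y)\<^sup>2 - (norm x + norm y)\<^sup>2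
        = (b * norm x - a * norm y)\<^sup>2 / (a * b)"
      using assms by (simp add: field_simps power2_eq_square)
    moreover have "0 \<le> (b * norm x - a * norm y)\<^sup>2 / (a * b)"
      using assms by simp
    ultimately show ?thesis by linarith
  qed
  finally show ?thesis .
qed

lemma L2_vec_add:
  assumes "F \<in> L2_vec M" "G \<in> L2_vec M"
  shows "(\<lambda>x. F x + G x) \<in> L2_vec M"
proof -
  have "integrable M (\<lambda>x. (norm (F x + G x))\<^sup>2)"
  proof (rule Bochner_Integration.integrable_bound)
    show "integrable M (\<lambda>x. 2 * (norm (F x))\<^sup>2 + 2 * (norm (G x))\<^sup>2)"
      using assms by (auto simp: L2_vec_def)
    show "(\<lambda>x. (norm (F x + G x))\<^sup>2) \<in> borel_measurable M"
      using assms by (auto simp: L2_vec_def)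
    show "AE x in M. norm ((norm (F x + G x))\<^sup>2) \<le> norm (2 * (norm (F x))\<^sup>2 + 2 * (norm (G x))\<^sup>2)"
      using norm_add_sq_le[of 1 1] by (auto intro!: AE_I2)
  qed
  then show ?thesis using assms by (auto simp: L2_vec_def)
qed

lemma L2_vec_scale:
  assumes "F \<in> L2_vec M" shows "(\<lambda>x. c *\<^sub>R F x) \<in> L2_vec M"
  using assms by (auto simp: L2_vec_def power_mult_distrib)

lemma L2_vec_diff:
  assumes "F \<in> L2_vec M" "G \<in> L2_vec M"
  shows "(\<lambda>x. F x - G x) \<in> L2_vec M"
  using L2_vec_add[OF assms(1) L2_vec_scale[OF assms(2), of "-1"]] by simp

lemma L2_vec_norm_scale: "L2_vec_norm M (\<lambda>x. c *\<^sub>R F x) = \<bar>c\<bar> * L2_vec_norm M F"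
  by (simp add: L2_vec_norm_def power_mult_distrib real_sqrt_mult)

text \<open>Integrating \<open>norm_add_sq_le\<close> with the two norms as weights gives the square
  of their sum, since \<open>(1 + b / a) * a\<^sup>2 + (1 + a / b) * b\<^sup>2 = (a +
  b)\<^sup>2\<close>.\<close>

lemma L2_vec_norm_triangle:
  assumes F: "F \<in> L2_vec M" and G: "G \<in> L2_vec M"
  shows "L2_vec_norm M (\<lambda>x. F x + G x) \<le> L2_vec_norm M F + L2_vec_norm M G"
proof (rule field_le_epsilon)
  fix e :: real assume e: "0 < e"
  \<comment> \<open>The extra \<open>e / 2\<close> keeps the weights positive even if a norm
    vanishes.\<close>
  define a where "a = L2_vec_norm M F + e / 2"
  define b where "b = L2_vec_norm M G + e / 2"
  have ab: "0 < a" "0 < b" using e by (auto simp: a_def b_def add_nonneg_pos)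
  have Fa: "(L2_vec_norm M F)\<^sup>2 \<le> a\<^sup>2" and Gb: "(L2_vec_norm M G)\<^sup>2 \<le> b\<^sup>2"
    using e by (auto simp: a_def b_def intro!: power_mono)
  have "(L2_vec_norm M (\<lambda>x. F x + G x))\<^sup>2
      \<le> (\<integral>x. (1 + b / a) * (norm (F x))\<^sup>2 + (1 + a / b) * (norm (G x))\<^sup>2 \<partial>M)"
    unfolding L2_vec_norm_power2 using L2_vec_add[OF F G] F G
    by (intro integral_mono norm_add_sq_le ab) (auto simp: L2_vec_def)
  also have "\<dots> = (1 + b / a) * (L2_vec_norm M F)\<^sup>2 + (1 + a / b) * (L2_vec_norm M G)\<^sup>2"
    unfolding L2_vec_norm_power2 using F G by (subst Bochner_Integration.integral_add) (auto simp: L2_vec_def)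
  also have "\<dots> \<le> (1 + b / a) * a\<^sup>2 + (1 + a / b) * b\<^sup>2"
    using ab Fa Gb by (intro add_mono mult_left_mono) auto
  also have "\<dots> = (a + b)\<^sup>2"
    using ab by (simp add: field_simps power2_eq_square)
  finally have "L2_vec_norm M (\<lambda>x. F x + G x) \<le> a + b"
    using ab by (meson add_pos_pos less_imp_le power2_le_imp_le)
  then show "L2_vec_norm M (\<lambda>x. F x + G x) \<le> L2_vec_norm M F + L2_vec_norm M G + e"
    by (simp add: a_def b_def)
qed

lemma L2_vec_norm_eq_0_iff:
  assumes "F \<in> L2_vec M"
  shows "L2_vec_norm M F = 0 \<longleftrightarrow> (AE x in M. F x = 0)"
  using assms integral_nonneg_eq_0_iff_AE[of M "\<lambda>x. (norm (F x))\<^sup>2"]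
  by (simp add: L2_vec_norm_def L2_vec_def)

lemma L2_vec_norm_cong_AE:
  assumes "F \<in> L2_vec M" "G \<in> L2_vec M" "AE x in M. F x = G x"
  shows "L2_vec_norm M F = L2_vec_norm M G"
  unfolding L2_vec_norm_def using assms by (intro arg_cong[where f=sqrt] integral_cong_AE) (auto simp: L2_vec_def)

lemma (in prob_space) L2_vec_integrable:
  assumes "F \<in> L2_vec M"
  shows "integrable M F"
proof (rule Bochner_Integration.integrable_bound)
  show "integrable M (\<lambda>x. 1 + (norm (F x))\<^sup>2)" using assms by (auto simp: L2_vec_def)
  \<comment> \<open>Expanding (|y| - 1/2)^2 >= 0 gives |y| <= |y|^2 + 1/4; constants are integrable
    on a probability space.\<close>
  have "norm y \<le> norm (1 + (norm y)\<^sup>2)" for y :: 'b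
    using zero_le_power2[of "norm y - 1/2"] by (simp add: power2_eq_square algebra_simps)
  then show "AE x in M. norm (F x) \<le> norm (1 + (norm (F x))\<^sup>2)" by auto
qed (use assms in \<open>auto simp: L2_vec_def\<close>)

text \<open>Jensen's inequality for the square, in the form that a variance is nonnegative.\<close>

lemma (in prob_space) integral_norm_le_L2_vec_norm:
  assumes "F \<in> L2_vec M"
  shows "(\<integral>x. norm (F x) \<partial>M) \<le> L2_vec_norm M F"
proof -
  have i: "integrable M (\<lambda>x. norm (F x))" "integrable M (\<lambda>x. (norm (F x))\<^sup>2)"
    using L2_vec_integrable[OF assms] assms by (auto simp: L2_vec_def)
  have "0 \<le> variance (\<lambda>x. norm (F x))" by simp
  also have "\<dots> = (\<integral>x. (norm (F x))\<^sup>2 \<partial>M) - (\<integral>x. norm (F x) \<partial>M)\<^sup>2"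
    using i by (rule variance_eq)
  finally show ?thesis unfolding L2_vec_norm_def by (intro real_le_rsqrt) simp
qed

text \<open>Riesz-Fischer: on a probability space the sequence is also Cauchy in L1, so a
  subsequence converges almost everywhere. Fatou's lemma along this subsequence carries the Cauchy
  bound over to the distance from the limit.\<close>

lemma (in prob_space) L2_vec_norm_complete:
  fixes s :: "nat \<Rightarrow> 'a \<Rightarrow> 'b::euclidean_space"
  assumes s: "\<And>n. s n \<in> L2_vec M"
    and cauchy: "\<And>e. 0 < e \<Longrightarrow> \<exists>n0. \<forall>m\<ge>n0. \<forall>n\<ge>n0. L2_vec_norm M (\<lambda>x. s m x - s n x) < e"
  obtains F where "F \<in> L2_vec M" "(\<lambda>n. L2_vec_norm M (\<lambda>x. s n x - F x)) \<longlonglongrightarrow> 0"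
proof -
  have [measurable]: "s n \<in> borel_measurable M" for n using s by (auto simp: L2_vec_def)
  obtain r where r: "strict_mono r" and Cr: "AE x in M. Cauchy (\<lambda>i. s (r i) x)"
  proof (rule cauchy_L1_AE_cauchy_subseq[of M s])
    show "integrable M (s n)" for n using s by (rule L2_vec_integrable)
    fix e :: real assume "0 < e"
    with cauchy obtain n0 where n0: "\<forall>m\<ge>n0. \<forall>n\<ge>n0. L2_vec_norm M (\<lambda>x. s m x - s n x) < e" by blast
    show "\<exists>N. \<forall>i\<ge>N. \<forall>j\<ge>N. (\<integral>x. norm (s i x - s j x) \<partial>M) < e"
      using n0 by (intro exI[of _ n0] allI impI
        le_less_trans[OF integral_norm_le_L2_vec_norm[OF L2_vec_diff[OF s s]]]) auto
  qed auto
  \<comment> \<open>Where the subsequence diverges, which happens only on a null set,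
    \<open>lim\<close> is some fixed value; \<open>F\<close> is still measurable.\<close>
  define F where "F x = lim (\<lambda>i. s (r i) x)" for x
  have [measurable]: "F \<in> borel_measurable M" unfolding F_def by measurable
  have lim: "AE x in M. (\<lambda>i. s (r i) x) \<longlonglongrightarrow> F x"
    using Cr unfolding F_def by eventually_elim (simp add: Cauchy_convergent convergent_LIMSEQ_iff[symmetric])
  have bnd: "s m \<in> L2_vec M \<and> (\<lambda>x. s m x - F x) \<in> L2_vec M \<and> L2_vec_norm M (\<lambda>x. s m x - F x) \<le> e"
    if e: "0 < e" and m: "m \<ge> n0" and n0: "\<forall>m\<ge>n0. \<forall>n\<ge>n0. L2_vec_norm M (\<lambda>x. s m x - s n x) < e" for e m n0
  proof -
    let ?f = "\<lambda>i x. ennreal ((norm (s m x - s (r i) x))\<^sup>2)"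
    have "(\<integral>\<^sup>+x. ennreal ((norm (s m x - F x))\<^sup>2) \<partial>M) = (\<integral>\<^sup>+x. liminf (\<lambda>i. ?f i x) \<partial>M)"
    proof (rule nn_integral_cong_AE, use lim in eventually_elim)
      fix x assume "(\<lambda>i. s (r i) x) \<longlonglongrightarrow> F x"
      then have "(\<lambda>i. ?f i x) \<longlonglongrightarrow> ennreal ((norm (s m x - F x))\<^sup>2)"
        by (intro tendsto_intros)
      then show "ennreal ((norm (s m x - F x))\<^sup>2) = liminf (\<lambda>i. ?f i x)"
        by (rule lim_imp_Liminf[OF sequentially_bot, symmetric])
    qed
    also have "\<dots> \<le> liminf (\<lambda>i. \<integral>\<^sup>+x. ?f i x \<partial>M)"
      by (rule nn_integral_liminf) simp
    also have "\<dots> \<le> ennreal (e\<^sup>2)"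
    proof (rule Liminf_le)
      show "\<forall>\<^sub>F i in sequentially. (\<integral>\<^sup>+x. ?f i x \<partial>M) \<le> ennreal (e\<^sup>2)"
        using eventually_ge_at_top[of n0]
      proof eventually_elim
        case (elim i)
        then have "r i \<ge> n0" using seq_suble[OF r, of i] by linarith
        then have "L2_vec_norm M (\<lambda>x. s m x - s (r i) x) \<le> e" using n0 m by (auto intro: less_imp_le)
        then have "(L2_vec_norm M (\<lambda>x. s m x - s (r i) x))\<^sup>2 \<le> e\<^sup>2" by (intro power_mono) auto
        then show ?case
          using L2_vec_diff[OF s[of m] s[of "r i"]] unfolding L2_vec_norm_power2
          by (subst nn_integral_eq_integral) (auto simp: L2_vec_def intro!: ennreal_leI)
      qed
    qed simp
    finally have le: "(\<integral>\<^sup>+x. ennreal ((norm (s m x - F x))\<^sup>2) \<partial>M) \<le> ennreal (e\<^sup>2)" .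
    have i: "integrable M (\<lambda>x. (norm (s m x - F x))\<^sup>2)"
      by (rule integrableI_bounded) (use le in \<open>auto intro: le_less_trans\<close>)
    have "(\<integral>x. (norm (s m x - F x))\<^sup>2 \<partial>M) \<le> e\<^sup>2"
      using le i by (subst (asm) nn_integral_eq_integral) auto
    then show ?thesis using i e s by (auto simp: L2_vec_norm_def L2_vec_def intro: real_le_lsqrt)
  qed
  show thesis
  proof
    obtain n0 where "\<forall>m\<ge>n0. \<forall>n\<ge>n0. L2_vec_norm M (\<lambda>x. s m x - s n x) < 1" using cauchy[of 1] by auto
    from bnd[OF _ order_refl this] have "s n0 \<in> L2_vec M" "(\<lambda>x. s n0 x - F x) \<in> L2_vec M" by auto
    from L2_vec_diff[OF this] show "F \<in> L2_vec M" by simp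
    show "(\<lambda>n. L2_vec_norm M (\<lambda>x. s n x - F x)) \<longlonglongrightarrow> 0"
    proof (rule LIMSEQ_I)
      fix e :: real assume e: "0 < e"
      \<comment> \<open>Fatou weakens the strict Cauchy bound to a weak one, hence
        \<open>e / 2\<close>.\<close>
      then obtain n0 where n0: "\<forall>m\<ge>n0. \<forall>n\<ge>n0. L2_vec_norm M (\<lambda>x. s m x - s n x) < e / 2"
        using cauchy[of "e / 2"] by auto
      have "L2_vec_norm M (\<lambda>x. s n x - F x) < e" if "n \<ge> n0" for n
        using bnd[OF _ that n0] e by auto
      then show "\<exists>no. \<forall>n\<ge>no. norm (L2_vec_norm M (\<lambda>x. s n x - F x) - 0) < e" by auto
    qed
  qed
qed

section \<open>Fourier coefficients on the torus\<close>

abbreviation cell :: "point set" where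
  "cell \<equiv> {0..<2*pi} \<times> {0..<2*pi}"

lemma cell_borel [measurable]: "cell \<in> sets borel"
  by (simp add: borel_prod[symmetric])

text \<open>The extended real quotient in \<open>uniform_measure\<close> becomes a real density, so
  that the density rules for Bochner integrals apply.\<close>

lemma torus_eq_density: "torus = density lborel (\<lambda>x. ennreal (indicator cell x / (4 * pi\<^sup>2)))"
proof -
  have "emeasure lborel cell = ennreal (2*pi) * ennreal (2*pi)"
    by (simp add: lborel_prod[symmetric] lborel.emeasure_pair_measure_Times)
  also have "\<dots> = ennreal (4 * pi\<^sup>2)"
    by (simp add: ennreal_mult[symmetric] power2_eq_square)
  finally have e: "emeasure lborel cell = ennreal (4 * pi\<^sup>2)" .
  have "indicator cell x / ennreal (4 * pi\<^sup>2) = ennreal (indicator cell x / (4 * pi\<^sup>2))" for x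
    using divide_ennreal[of 1 "4 * pi\<^sup>2"] by (cases "x \<in> cell") simp_all
  then show ?thesis unfolding torus_def uniform_measure_def e by simp
qed

lemma sets_torus [measurable_cong, simp]: "sets torus = sets borel"
  by (simp add: torus_eq_density)

lemma space_torus [simp]: "space torus = UNIV"
  by (simp add: torus_eq_density)

lemma integral_torus:
  fixes f :: "point \<Rightarrow> 'b::{banach, second_countable_topology}"
  assumes [measurable]: "f \<in> borel_measurable borel"
  shows "(\<integral>x. f x \<partial>torus) = (\<integral>x. indicator cell x *\<^sub>R f x \<partial>lborel) /\<^sub>R (4 * pi\<^sup>2)"
proof -
  have "(\<integral>x. f x \<partial>torus) = (\<integral>x. (indicator cell x / (4 * pi\<^sup>2)) *\<^sub>R f x \<partial>lborel)"
    unfolding torus_eq_density by (rule integral_density) auto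
  also have "\<dots> = (\<integral>x. inverse (4 * pi\<^sup>2) *\<^sub>R (indicator cell x *\<^sub>R f x) \<partial>lborel)"
  proof -
    have "(indicator cell x / (4 * pi\<^sup>2)) *\<^sub>R f x = inverse (4 * pi\<^sup>2) *\<^sub>R (indicator cell x *\<^sub>R f x)" for x
      by (simp add: indicator_def inverse_eq_divide)
    then show ?thesis by (simp only:)
  qed
  also have "\<dots> = (\<integral>x. indicator cell x *\<^sub>R f x \<partial>lborel) /\<^sub>R (4 * pi\<^sup>2)"
    by (rule integral_scaleR_right)
  finally show ?thesis .
qed

lemma prob_space_torus: "prob_space torus"
  unfolding torus_def
proof (rule prob_space_uniform_measure)
  have "emeasure lborel cell = ennreal (2*pi) * ennreal (2*pi)"
    by (simp add: lborel_prod[symmetric] lborel.emeasure_pair_measure_Times)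
  then show "emeasure lborel cell \<noteq> 0" "emeasure lborel cell \<noteq> \<infinity>"
    by (simp_all add: ennreal_mult[symmetric])
qed

interpretation torus: prob_space torus
  by (rule prob_space_torus)

lemma AE_torus_iff: "(AE x in torus. P x) \<longleftrightarrow> (AE x in lborel. x \<in> cell \<longrightarrow> P x)"
  unfolding torus_eq_density
  by (subst AE_density) (auto simp: indicator_def)

section \<open>Orthogonality of the characters\<close>

lemma integral_cis_circle:
  "(\<integral>s. indicator {0..<2*pi} s *\<^sub>R cis (of_int n * s) \<partial>lborel) = (if n = 0 then 2*pi else 0)"
proof -
  have [measurable]: "(\<lambda>s::real. cis (of_int n * s)) \<in> borel_measurable borel"
    by (intro borel_measurable_continuous_onI continuous_intros)
  \<comment> \<open>Adding the right end point changes only a null set and allows the fundamental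
    theorem of calculus; for \<open>n\<close> nonzero the antiderivative is periodic, so its
    increment vanishes.\<close>
  have "(\<integral>s. indicator {0..<2*pi} s *\<^sub>R cis (of_int n * s) \<partial>lborel)
      = (\<integral>s. indicator {0..2*pi} s *\<^sub>R cis (of_int n * s) \<partial>lborel)"
  proof (rule integral_cong_AE)
    show "AE s in lborel. indicator {0..<2*pi} s *\<^sub>R cis (of_int n * s)
        = indicator {0..2*pi} s *\<^sub>R cis (of_int n * s)"
      using AE_lborel_singleton[of "2*pi"] by eventually_elim (auto split: split_indicator)
  qed measurable
  also have "\<dots> = (if n = 0 then 2*pi else 0)"
  proof (cases "n = 0")
    case False
    let ?F = "\<lambda>s. cis (of_int n * s) / (\<i> * of_int n)"
    have "(\<integral>s. indicator {0..2*pi} s *\<^sub>R cis (of_int n * s) \<partial>lborel) = ?F (2*pi) - ?F 0"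
    proof (rule integral_FTC_Icc)
      fix s :: real
      show "(?F has_vector_derivative cis (of_int n * s)) (at s within {0..2*pi})"
        using False unfolding cis_conv_exp
        by (auto intro!: derivative_eq_intros has_vector_derivative_real_field simp: field_simps)
    next
      show "continuous_on {0..2*pi} (\<lambda>s. cis (of_int n * s))" by (intro continuous_intros)
    qed simp
    also have "\<dots> = 0"
      using cis_multiple_2pi[of "of_int n"] by (simp add: mult.commute)
    finally show ?thesis using False by simp
  qed (simp add: scaleR_conv_of_real)
  finally show ?thesis .
qed

lemma kvec_inner: "kvec k \<bullet> x = of_int (fst k) * fst x + of_int (snd k) * snd x"
  by (cases x) (simp add: kvec_def inner_prod_def)

lemma kvec_add: "kvec (k + l) = kvec k + kvec l"
  by (simp add: kvec_def)

lemma kvec_minus: "kvec (- k) = - kvec k"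
  by (simp add: kvec_def)

lemma kvec_0 [simp]: "kvec 0 = 0"
  by (simp add: kvec_def prod_eq_iff)

lemma borel_measurable_cis_kvec [measurable]: "(\<lambda>x. cis (kvec k \<bullet> x)) \<in> borel_measurable borel"
  by (intro borel_measurable_continuous_onI continuous_intros)

lemma borel_measurable_cis_minus_kvec [measurable]: "(\<lambda>x. cis (- (kvec k \<bullet> x))) \<in> borel_measurable borel"
  by (intro borel_measurable_continuous_onI continuous_intros)

lemma integral_torus_character: "(\<integral>x. cis (kvec k \<bullet> x) \<partial>torus) = (if k = 0 then 1 else 0)"
proof -
  let ?c = "\<lambda>n s. indicator {0..<2*pi} s *\<^sub>R cis (of_int n * s)"
  have m [measurable]: "(\<lambda>s::real. cis (of_int n * s)) \<in> borel_measurable borel" for n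
    by (intro borel_measurable_continuous_onI continuous_intros)
  have split: "indicator cell (s, t) *\<^sub>R cis (kvec k \<bullet> (s, t)) = ?c (fst k) s * ?c (snd k) t" for s t
    by (simp add: kvec_inner cis_mult indicator_times)
  have i: "integrable lborel (\<lambda>x. indicator cell x *\<^sub>R cis (kvec k \<bullet> x))"
  proof (rule integrableI_bounded_set_indicator[where B=1])
    show "emeasure lborel cell < \<infinity>"
      by (simp add: lborel_prod[symmetric] lborel.emeasure_pair_measure_Times ennreal_mult[symmetric])
  qed simp_all
  have "(\<integral>x. indicator cell x *\<^sub>R cis (kvec k \<bullet> x) \<partial>lborel)
      = (\<integral>s. \<integral>t. indicator cell (s, t) *\<^sub>R cis (kvec k \<bullet> (s, t)) \<partial>lborel \<partial>lborel)"
    using i lborel_pair.integral_fst'[of "\<lambda>x. indicator cell x *\<^sub>R cis (kvec k \<bullet> x)"]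
    unfolding lborel_prod by (simp only:)
  also have "\<dots> = (\<integral>s. ?c (fst k) s \<partial>lborel) * (\<integral>t. ?c (snd k) t \<partial>lborel)"
  proof -
    have "(\<integral>t. ?c (fst k) s * ?c (snd k) t \<partial>lborel) = ?c (fst k) s * (\<integral>t. ?c (snd k) t \<partial>lborel)" for s
      by (rule integral_mult_right_zero)
    then show ?thesis unfolding split by (simp only: integral_mult_left_zero)
  qed
  also have "\<dots> = (if k = 0 then of_real (4 * pi\<^sup>2) else 0)"
    unfolding integral_cis_circle by (auto simp: prod_eq_iff power2_eq_square)
  finally show ?thesis
    by (subst integral_torus) (auto simp: scaleR_conv_of_real)
qed


text \<open>
  Multiplication by a character only shifts the coefficients, so their vanishing survives
  multiplication by polynomials in \<open>(e\<^sup>i\<^sup>s, e\<^sup>i\<^sup>t)\<close>; Stone--Weierstrass on the product of the circles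
  then gives orthogonality to continuous functions and finally to indicators of Borel sets.
\<close>

definition torus_null :: "(point \<Rightarrow> complex) \<Rightarrow> bool" where
  "torus_null h \<longleftrightarrow> integrable torus h \<and> (\<forall>k. (\<integral>x. h x * cis (- (kvec k \<bullet> x)) \<partial>torus) = 0)"

definition circles :: "point \<Rightarrow> complex \<times> complex" where
  "circles x = (cis (fst x), cis (snd x))"

lemma continuous_circles [continuous_intros]: "continuous_on S circles"
  unfolding circles_def by (intro continuous_intros)

lemma circles_measurable [measurable]: "circles \<in> borel_measurable borel"
  by (intro borel_measurable_continuous_onI continuous_intros)

lemma integrable_torus_mult_bounded:
  fixes h q :: "point \<Rightarrow> complex"
  assumes "integrable torus h" "q \<in> borel_measurable borel" "\<And>x. cmod (q x) \<le> B"
  shows "integrable torus (\<lambda>x. h x * q x)"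
proof (rule Bochner_Integration.integrable_bound)
  show "integrable torus (\<lambda>x. B *\<^sub>R h x)" using assms by simp
  have "cmod (h x * q x) \<le> cmod (B *\<^sub>R h x)" for x
    using mult_right_mono[OF order_trans[OF assms(3) abs_ge_self], of "cmod (h x)" x]
    by (simp add: norm_mult mult.commute)
  then show "AE x in torus. cmod (h x * q x) \<le> cmod (B *\<^sub>R h x)" by simp
qed (use assms in measurable)

lemma torus_null_add: "torus_null h \<Longrightarrow> torus_null g \<Longrightarrow> torus_null (\<lambda>x. h x + g x)"
  unfolding torus_null_def
  by (simp add: distrib_right integrable_torus_mult_bounded[where B=1])

lemma torus_null_scale: "torus_null h \<Longrightarrow> torus_null (\<lambda>x. h x * c)"
  unfolding torus_null_def by (simp add: mult.assoc mult.left_commute[of _ c] del: split_paired_All)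

text \<open>The coefficient at \<open>k\<close> of the product is the coefficient of
  \<open>h\<close> at \<open>k - m\<close>.\<close>

lemma torus_null_shift:
  assumes "torus_null h"
  shows "torus_null (\<lambda>x. h x * cis (kvec m \<bullet> x))"
proof -
  have "h x * cis (kvec m \<bullet> x) * cis (- (kvec k \<bullet> x)) = h x * cis (- (kvec (k - m) \<bullet> x))" for k x
    by (simp only: mult.assoc cis_mult) (simp add: kvec_inner algebra_simps)
  then have "(\<integral>x. h x * cis (kvec m \<bullet> x) * cis (- (kvec k \<bullet> x)) \<partial>torus)
      = (\<integral>x. h x * cis (- (kvec (k - m) \<bullet> x)) \<partial>torus)" for k
    by (simp only:)
  then show ?thesis
    using assms by (simp add: torus_null_def integrable_torus_mult_bounded[where B=1] del: split_paired_All)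
qed

text \<open>On the product of the circles a real linear functional is a combination of cos s, sin s,
  cos t and sin t, hence of the four characters with frequencies (1,0), (-1,0), (0,1), (0,-1). Such
  functionals generate \<open>real_polynomial_function\<close>.\<close>

lemma torus_null_mult_linear:
  fixes g :: "complex \<times> complex \<Rightarrow> real"
  assumes "bounded_linear g" and h: "torus_null h"
  shows "torus_null (\<lambda>x. h x * of_real (g (circles x)))"
proof -
  interpret g: bounded_linear g by fact
  let ?a = "complex_of_real (g (1, 0))" and ?b = "complex_of_real (g (\<i>, 0))"
  let ?c = "complex_of_real (g (0, 1))" and ?d = "complex_of_real (g (0, \<i>))"
  have "h x * of_real (g (circles x)) =
     h x * cis (kvec (1, 0) \<bullet> x) * ((?a - \<i> * ?b) / 2) + h x * cis (kvec (-1, 0) \<bullet> x) * ((?a + \<i> * ?b) / 2) +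
     (h x * cis (kvec (0, 1) \<bullet> x) * ((?c - \<i> * ?d) / 2) + h x * cis (kvec (0, -1) \<bullet> x) * ((?c + \<i> * ?d) / 2))" for x
  proof -
    have "circles x = cos (fst x) *\<^sub>R (1, 0) + sin (fst x) *\<^sub>R (\<i>, 0) + cos (snd x) *\<^sub>R (0, 1) + sin (snd x) *\<^sub>R (0, \<i>)"
      by (simp add: circles_def complex_eq_iff)
    then have "g (circles x) = cos (fst x) * g (1, 0) + sin (fst x) * g (\<i>, 0) + cos (snd x) * g (0, 1) + sin (snd x) * g (0, \<i>)"
      by (simp only: g.add g.scaleR real_scaleR_def)
    then have "complex_of_real (g (circles x)) =
        of_real (cos (fst x) * g (1, 0) + sin (fst x) * g (\<i>, 0)) + of_real (cos (snd x) * g (0, 1) + sin (snd x) * g (0, \<i>))"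
      by (simp only: add.assoc of_real_add)
    moreover have "complex_of_real (cos t * a + sin t * b) =
        cis t * ((of_real a - \<i> * of_real b) / 2) + cis (- t) * ((of_real a + \<i> * of_real b) / 2)" for t a b
      by (simp add: complex_eq_iff field_simps)
    ultimately have "of_real (g (circles x)) =
        cis (fst x) * ((?a - \<i> * ?b) / 2) + cis (- fst x) * ((?a + \<i> * ?b) / 2) +
        (cis (snd x) * ((?c - \<i> * ?d) / 2) + cis (- snd x) * ((?c + \<i> * ?d) / 2))"
      by (simp only:)
    then show ?thesis
      by (simp only: kvec_inner fst_conv snd_conv of_int_1 of_int_0 of_int_minus) (simp add: algebra_simps)
  qed
  then show ?thesis
    by (simp only:) (intro torus_null_add torus_null_scale torus_null_shift h)
qed

lemma torus_null_mult_polynomial: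
  fixes p :: "complex \<times> complex \<Rightarrow> real"
  assumes "real_polynomial_function p" "torus_null h"
  shows "torus_null (\<lambda>x. h x * of_real (p (circles x)))"
  using assms
\<comment> \<open>\<open>h\<close> must vary: for a product, the hypothesis for the second factor is
  applied to \<open>h\<close> already multiplied by the first.\<close>
proof (induction arbitrary: h rule: real_polynomial_function.induct)
  case (linear f) then show ?case by (rule torus_null_mult_linear)
next
  case (const c) then show ?case by (rule torus_null_scale)
next
  case (add f g) then show ?case by (simp add: distrib_left torus_null_add)
next
  case (mult f g)
  from mult.IH(2)[OF mult.IH(1)[OF mult.prems]] show ?case by (simp add: mult.assoc)
qed

text \<open>If p is a polynomial within e of G on the product of the circles, the integral of hG
  equals that of h(G - p), which is at most e times the L1 norm of h.\<close>

lemma torus_null_continuous: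
  fixes G :: "complex \<times> complex \<Rightarrow> real"
  assumes h: "torus_null h" and G: "continuous_on UNIV G"
  shows "(\<integral>x. h x * of_real (G (circles x)) \<partial>torus) = 0"
proof -
  have S: "compact (sphere 0 1 \<times> sphere 0 1 :: (complex \<times> complex) set)"
    by (intro compact_Times compact_sphere)
  have circ: "circles x \<in> sphere 0 1 \<times> sphere 0 1" for x by (simp add: circles_def)
  have hi: "integrable torus h" using h by (simp add: torus_null_def)
  have [measurable]: "G \<in> borel_measurable borel"
    using G by (rule borel_measurable_continuous_onI)
  have bound: "cmod (\<integral>x. h x * of_real (G (circles x)) \<partial>torus) \<le> e * (\<integral>x. cmod (h x) \<partial>torus)" if "0 < e" for e
  proof -
    obtain p where p: "real_polynomial_function p" "\<And>z. z \<in> sphere 0 1 \<times> sphere 0 1 \<Longrightarrow> \<bar>G z - p z\<bar> < e"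
      using Stone_Weierstrass_real_polynomial_function[OF S continuous_on_subset[OF G subset_UNIV] \<open>0 < e\<close>] by metis
    have hp: "torus_null (\<lambda>x. h x * of_real (p (circles x)))"
      using p(1) h by (rule torus_null_mult_polynomial)
    \<comment> \<open>The coefficient at frequency 0 is the plain integral.\<close>
    from hp have "(\<integral>x. h x * of_real (p (circles x)) * cis (- (kvec 0 \<bullet> x)) \<partial>torus) = 0"
      unfolding torus_null_def by blast
    then have p0: "(\<integral>x. h x * of_real (p (circles x)) \<partial>torus) = 0" by simp
    have [measurable]: "p \<in> borel_measurable borel"
      using p(1) by (intro borel_measurable_continuous_onI continuous_on_polymonial_function)
        (simp add: real_polynomial_function_eq)
    have b: "cmod (of_real (G (circles x) - p (circles x))) \<le> e" for x
      using p(2)[OF circ[of x]] by (simp del: of_real_diff)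
    have i: "integrable torus (\<lambda>x. h x * of_real (G (circles x) - p (circles x)))"
      by (rule integrable_torus_mult_bounded[OF hi _ b]) measurable
    have "integrable torus (\<lambda>x. h x * of_real (G (circles x) - p (circles x)) + h x * of_real (p (circles x)))"
      using i hp by (simp only: Bochner_Integration.integrable_add torus_null_def)
    then have iG: "integrable torus (\<lambda>x. h x * of_real (G (circles x)))"
      by (simp add: algebra_simps)
    have "(\<integral>x. h x * of_real (G (circles x)) \<partial>torus) = (\<integral>x. h x * of_real (G (circles x) - p (circles x)) \<partial>torus)"
      using iG hp p0 by (simp add: right_diff_distrib torus_null_def)
    also have "cmod \<dots> \<le> (\<integral>x. e * cmod (h x) \<partial>torus)"
    proof (rule order_trans[OF integral_norm_bound integral_mono])
      show "integrable torus (\<lambda>x. cmod (h x * of_real (G (circles x) - p (circles x))))" using i by (rule integrable_norm)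
      show "integrable torus (\<lambda>x. e * cmod (h x))" using hi by simp
      show "cmod (h x * of_real (G (circles x) - p (circles x))) \<le> e * cmod (h x)" for x
        using mult_right_mono[OF b, of "cmod (h x)"] by (simp add: norm_mult mult.commute del: of_real_diff)
    qed
    finally show ?thesis by simp
  qed
  have "cmod (\<integral>x. h x * of_real (G (circles x)) \<partial>torus) \<le> 0 + e" if "0 < e" for e :: real
  proof -
    \<comment> \<open>Dividing by \<open>?I + 1\<close> instead of \<open>?I\<close> covers the case
      where \<open>h\<close> vanishes almost everywhere.\<close>
    let ?I = "\<integral>x. cmod (h x) \<partial>torus"
    have "0 \<le> ?I" by simp
    then have I: "0 < ?I + 1" by linarith
    have "e * ?I \<le> e * (?I + 1)" using that by (intro mult_left_mono) auto
    then have "e / (?I + 1) * ?I \<le> e" using I by (simp add: pos_divide_le_eq)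
    moreover have "0 < e / (?I + 1)" using I that by (intro divide_pos_pos) auto
    ultimately show ?thesis
      using bound[of "e / (?I + 1)"] by linarith
  qed
  then have "cmod (\<integral>x. h x * of_real (G (circles x)) \<partial>torus) \<le> 0" by (rule field_le_epsilon)
  then show ?thesis by simp
qed

text \<open>The continuous functions \<open>G n\<close> increase to the indicator of
  \<open>S\<close>, because points of an open set have positive distance to its complement;
  dominated convergence concludes.\<close>

lemma torus_null_open:
  assumes h: "torus_null h" and S: "open S"
  shows "(\<integral>x. h x * indicator S (circles x) \<partial>torus) = 0"
proof (cases "S = UNIV")
  \<comment> \<open>The whole space is treated separately: its complement is empty, and the distance
    \<open>infdist\<close> to the empty set is 0, so the approximations would all vanish.\<close>
  case True
  then show ?thesis using torus_null_continuous[OF h, of "\<lambda>_. 1"] by simp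
next
  case False
  have hi [measurable]: "integrable torus h" "h \<in> borel_measurable torus" using h by (auto simp: torus_null_def)
  have [measurable]: "S \<in> sets borel" using S by simp
  define G where "G n z = min 1 (real n * infdist z (- S))" for n z
  have G_cont: "continuous_on UNIV (G n)" for n
    unfolding G_def by (intro continuous_intros)
  have [measurable]: "G n \<in> borel_measurable borel" for n
    using G_cont by (rule borel_measurable_continuous_onI)
  have G_lim: "(\<lambda>n. G n z) \<longlonglongrightarrow> indicator S z" for z
  proof (cases "z \<in> S")
    case True
    then have pos: "0 < infdist z (- S)"
      using S False in_closed_iff_infdist_zero[of "- S" z] infdist_nonneg[of z "- S"] by fastforce
    obtain N :: nat where N: "1 < real N * infdist z (- S)"
      using reals_Archimedean3[OF pos] by blast
    have "G n z = 1" if "n \<ge> N" for n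
    proof -
      have "real N * infdist z (- S) \<le> real n * infdist z (- S)" using pos that by simp
      with N show ?thesis by (simp add: G_def)
    qed
    then have "eventually (\<lambda>n. G n z = indicator S z) sequentially"
      using True by (auto simp: eventually_sequentially)
    then show ?thesis by (rule tendsto_eventually)
  qed (simp add: G_def)
  have "(\<lambda>n. \<integral>x. h x * of_real (G n (circles x)) \<partial>torus) \<longlonglongrightarrow> (\<integral>x. h x * of_real (indicator S (circles x)) \<partial>torus)"
  proof (rule integral_dominated_convergence[where w="\<lambda>x. cmod (h x)"])
    show "AE x in torus. (\<lambda>n. h x * of_real (G n (circles x))) \<longlonglongrightarrow> h x * of_real (indicator S (circles x))"
      by (intro AE_I2 tendsto_intros G_lim)
    have "\<bar>G n z\<bar> \<le> 1" for n z by (simp add: G_def infdist_nonneg)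
    then show "AE x in torus. cmod (h x * of_real (G n (circles x))) \<le> cmod (h x)" for n
      by (auto simp: norm_mult mult_left_le)
  qed (use hi in auto)
  moreover have "(\<lambda>n. \<integral>x. h x * of_real (G n (circles x)) \<partial>torus) = (\<lambda>n. 0)"
    using torus_null_continuous[OF h G_cont] by simp
  moreover have "complex_of_real (indicator S z) = indicator S z" for z by (simp add: indicator_def)
  ultimately show ?thesis by (simp add: LIMSEQ_const_iff)
qed

text \<open>Dynkin's argument: open sets form a generator stable under intersection. Complements use
  the open set \<open>UNIV\<close>, and disjoint unions use dominated convergence with majorant
  |h|.\<close>

lemma torus_null_borel:
  assumes h: "torus_null h" and B: "B \<in> sets borel"
  shows "(\<integral>x. h x * indicator B (circles x) \<partial>torus) = 0"
proof -
  have hi [measurable]: "integrable torus h" "h \<in> borel_measurable torus" using h by (auto simp: torus_null_def)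
  have i: "integrable torus (\<lambda>x. h x * indicator A (circles x))" if [measurable]: "A \<in> sets borel" for A
    by (rule integrable_torus_mult_bounded[where B=1]) (auto simp: hi indicator_def)
  have "Int_stable {S :: (complex \<times> complex) set. open S}" "{S :: (complex \<times> complex) set. open S} \<subseteq> Pow UNIV"
    by (auto simp: Int_stable_def)
  moreover from B have "B \<in> sigma_sets UNIV {S. open S}" by (simp add: borel_def)
  ultimately show ?thesis
  proof (induction rule: sigma_sets_induct_disjoint)
    case (basic A) then show ?case using torus_null_open[OF h] by simp
  next
    case empty then show ?case by simp
  next
    case (compl A)
    then have A: "A \<in> sets borel" by (simp add: borel_def)
    have "(\<integral>x. h x * indicator (UNIV - A) (circles x) \<partial>torus)
        = (\<integral>x. h x * indicator UNIV (circles x) - h x * indicator A (circles x) \<partial>torus)"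
      by (intro Bochner_Integration.integral_cong) (auto simp: indicator_def)
    also have "\<dots> = 0"
      using compl.IH torus_null_open[OF h, of UNIV] i[OF A] hi by simp
    finally show ?case .
  next
    case (union A)
    then have A [measurable]: "A n \<in> sets borel" for n by (auto simp: borel_def)
    have "(\<lambda>n. \<integral>x. h x * indicator (\<Union>i<n. A i) (circles x) \<partial>torus) \<longlonglongrightarrow>
        (\<integral>x. h x * indicator (\<Union>i. A i) (circles x) \<partial>torus)"
    proof (rule integral_dominated_convergence[where w="\<lambda>x. cmod (h x)"])
      show "AE x in torus. (\<lambda>n. h x * indicator (\<Union>i<n. A i) (circles x)) \<longlonglongrightarrow>
          h x * indicator (\<Union>i. A i) (circles x)"
        by (intro AE_I2 tendsto_intros LIMSEQ_indicator_UN)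
    qed (auto simp: hi indicator_def)
    moreover have "(\<integral>x. h x * indicator (\<Union>i<n. A i) (circles x) \<partial>torus) = 0" for n
    proof -
      have "indicator (\<Union>i<n. A i) z = (\<Sum>i<n. indicator (A i) z :: complex)" for z
        using union.hyps(1) by (intro indicator_UN_disjoint) (auto simp: disjoint_family_on_def)
      then have "(\<integral>x. h x * indicator (\<Union>i<n. A i) (circles x) \<partial>torus) =
          (\<Sum>i<n. \<integral>x. h x * indicator (A i) (circles x) \<partial>torus)"
        by (simp only: sum_distrib_left Bochner_Integration.integral_sum i[OF A])
      then show ?thesis using union.IH by simp
    qed
    ultimately show ?case by (simp add: LIMSEQ_const_iff)
  qed
qed

text \<open>The arguments of \<open>- cis s\<close> and \<open>- cis t\<close> recover \<open>(s, t)\<close> measurably from the two circles.\<close>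

lemma circles_left_inverse:
  obtains \<psi> :: "complex \<times> complex \<Rightarrow> point"
  where "\<psi> \<in> borel_measurable borel" "AE x in torus. \<psi> (circles x) = x"
proof -
  \<comment> \<open>\<open>Arg\<close> is discontinuous along the nonpositive real axis; the value 0
    there makes \<open>a\<close> piecewise continuous and hence Borel.\<close>
  define a where "a z = (if z \<in> \<real>\<^sub>\<le>\<^sub>0 then 0 else Arg z)" for z
  have [measurable]: "a \<in> borel_measurable borel"
    unfolding a_def
    by (rule borel_measurable_continuous_on_if)
      (auto intro!: borel_closed continuous_at_imp_continuous_on continuous_at_Arg)
  have a: "a (- cis s) + pi = s" if "0 < s" "s < 2 * pi" for s
  proof -
    have e: "- cis s = cis (s - pi)" by (simp add: complex_eq_iff cos_diff sin_diff)
    have A: "Arg (cis (s - pi)) = s - pi" using that by (intro Arg_cis) auto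
    have "cis (s - pi) \<notin> \<real>\<^sub>\<le>\<^sub>0"
    proof
      assume "cis (s - pi) \<in> \<real>\<^sub>\<le>\<^sub>0"
      then obtain r where "cis (s - pi) = of_real r" "r \<le> 0"
        by (auto elim: nonpos_Reals_cases)
      then have "Arg (cis (s - pi)) = pi"
        by (metis Arg_eq_pi Re_complex_of_real Im_complex_of_real cis_neq_zero of_real_0 order_le_less)
      with A that show False by simp
    qed
    with A show ?thesis by (simp add: a_def e)
  qed
  define \<psi> where "\<psi> z = (a (- fst z) + pi, a (- snd z) + pi)" for z
  show thesis
  proof
    show "\<psi> \<in> borel_measurable borel" unfolding \<psi>_def borel_prod[symmetric] by measurable
    \<comment> \<open>For s = 0 or t = 0 the point -1 lies on the branch cut and the inversion
      fails; these two lines are null sets.\<close>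
    have "AE x in lborel. (x :: point) \<notin> {0} \<times> UNIV"
      by (rule AE_not_in) (auto simp: null_sets_def lborel_prod[symmetric] lborel.emeasure_pair_measure_Times)
    moreover have "AE x in lborel. (x :: point) \<notin> UNIV \<times> {0}"
      by (rule AE_not_in) (auto simp: null_sets_def lborel_prod[symmetric] lborel.emeasure_pair_measure_Times)
    ultimately show "AE x in torus. \<psi> (circles x) = x"
      unfolding AE_torus_iff
    proof eventually_elim
      case (elim x)
      then show ?case by (cases x) (auto simp: \<psi>_def circles_def a)
    qed
  qed
qed

lemma fcoef_eq_0_imp_AE_0:
  assumes f: "integrable torus f" and z: "\<And>k. fcoef f k = 0"
  shows "AE x in torus. f x = 0"
proof -
  have [measurable]: "f \<in> borel_measurable borel" using f by simp
  have h: "torus_null (\<lambda>x. complex_of_real (f x))"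
    using f z by (simp add: torus_null_def fcoef_def)
  obtain \<psi> where [measurable]: "\<psi> \<in> borel_measurable borel" and \<psi>: "AE x in torus. \<psi> (circles x) = x"
    by (rule circles_left_inverse)
  have i: "integrable torus (\<lambda>x. f x * indicator A x)" if "A \<in> sets borel" for A
    using f that integrable_mult_indicator[of A torus f] by (simp add: mult.commute)
  have int0: "(\<integral>x. f x * indicator A x \<partial>torus) = 0" if [measurable]: "A \<in> sets borel" for A
  proof -
    have "\<psi> -` A \<in> sets borel" using measurable_sets[of \<psi> borel borel A] by simp
    then have "0 = (\<integral>x. complex_of_real (f x) * indicator (\<psi> -` A) (circles x) \<partial>torus)"
      using torus_null_borel[OF h] by simp
    also have "\<dots> = (\<integral>x. complex_of_real (f x * indicator A x) \<partial>torus)"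
    proof (rule integral_cong_AE)
      show "AE x in torus. complex_of_real (f x) * indicator (\<psi> -` A) (circles x) = complex_of_real (f x * indicator A x)"
        using \<psi> by eventually_elim (simp add: indicator_def)
    qed measurable
    also have "\<dots> = of_real (\<integral>x. f x * indicator A x \<partial>torus)"
      using i[OF that] by (rule integral_of_real)
    finally show ?thesis by simp
  qed
  have "AE x in torus. f x * indicator {x. 0 < f x} x = 0"
    using int0[of "{x. 0 < f x}"] i[of "{x. 0 < f x}"]
      integral_nonneg_eq_0_iff_AE[of torus "\<lambda>x. f x * indicator {x. 0 < f x} x"]
    by (simp add: indicator_def)
  moreover have "AE x in torus. - (f x * indicator {x. f x < 0} x) = 0"
    using int0[of "{x. f x < 0}"] i[of "{x. f x < 0}"]
      integral_nonneg_eq_0_iff_AE[of torus "\<lambda>x. - (f x * indicator {x. f x < 0} x)"]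
    by (simp add: indicator_def)
  ultimately show ?thesis by eventually_elim (auto simp: indicator_def split: if_splits)
qed


section \<open>Continuous doubly periodic functions\<close>

lemma doubly_periodic_shift:
  assumes "doubly_periodic f"
  shows "f (x + 2 * pi * of_int m, y + 2 * pi * of_int n) = f (x, y)"
proof -
  have 1: "f (x + 2 * pi * of_int m, y) = f (x, y)" for x y m
  proof (induction m rule: int_induct[where k=0])
    case (step1 i)
    then show ?case using assms[unfolded doubly_periodic_def, rule_format, of "x + 2 * pi * of_int i" y]
      by (simp add: algebra_simps)
  next
    case (step2 i)
    then show ?case using assms[unfolded doubly_periodic_def, rule_format, of "x + 2 * pi * of_int (i - 1)" y]
      by (simp add: algebra_simps)
  qed simp
  have 2: "f (x, y + 2 * pi * of_int n) = f (x, y)" for x y n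
  proof (induction n rule: int_induct[where k=0])
    case (step1 i)
    then show ?case using assms[unfolded doubly_periodic_def, rule_format, of x "y + 2 * pi * of_int i"]
      by (simp add: algebra_simps)
  next
    case (step2 i)
    then show ?case using assms[unfolded doubly_periodic_def, rule_format, of x "y + 2 * pi * of_int (i - 1)"]
      by (simp add: algebra_simps)
  qed simp
  show ?thesis by (simp add: 1 2)
qed

lemma doubly_periodic_reduce:
  assumes "doubly_periodic f"
  obtains y where "y \<in> cell" "f x = f y"
proof -
  define m where "m t = \<lfloor>t / (2 * pi)\<rfloor>" for t
  have m: "0 \<le> t - 2 * pi * of_int (m t)" "t - 2 * pi * of_int (m t) < 2 * pi" for t
  proof -
    have "of_int (m t) \<le> t / (2 * pi)" "t / (2 * pi) < of_int (m t) + 1"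
      using floor_correct[of "t / (2 * pi)"] by (auto simp: m_def)
    then show "0 \<le> t - 2 * pi * of_int (m t)" "t - 2 * pi * of_int (m t) < 2 * pi"
      by (simp_all add: field_simps)
  qed
  show thesis
  proof
    show "(fst x - 2 * pi * of_int (m (fst x)), snd x - 2 * pi * of_int (m (snd x))) \<in> cell"
      using m by auto
    show "f x = f (fst x - 2 * pi * of_int (m (fst x)), snd x - 2 * pi * of_int (m (snd x)))"
      using doubly_periodic_shift[OF assms, of "fst x" "- m (fst x)" "snd x" "- m (snd x)"] by simp
  qed
qed

lemma continuous_periodic_bounded:
  fixes f :: "point \<Rightarrow> real"
  assumes "continuous_on UNIV f" "doubly_periodic f"
  obtains B where "0 \<le> B" "\<And>x. \<bar>f x\<bar> \<le> B"
proof -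
  have "compact ({0..2*pi} \<times> {0..2*pi} :: point set)" by (intro compact_Times compact_Icc)
  then have "bounded (f ` ({0..2*pi} \<times> {0..2*pi}))"
    using assms(1) by (intro compact_imp_bounded compact_continuous_image) (auto intro: continuous_on_subset)
  then obtain B where B: "\<forall>y\<in>f ` ({0..2*pi} \<times> {0..2*pi}). norm y \<le> B" by (auto simp: bounded_iff)
  have "\<bar>f x\<bar> \<le> B" for x
  proof -
    obtain y where "y \<in> cell" "f x = f y" using doubly_periodic_reduce[OF assms(2)] .
    then show ?thesis using B by (force simp: less_imp_le)
  qed
  moreover from this have "0 \<le> B" by (meson abs_ge_zero order_trans)
  ultimately show thesis using that by blast
qed

text \<open>The set where f is nonzero inside the open cell is open and null, hence empty.
  Continuity extends this to the edges and periodicity to the plane.\<close>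

lemma continuous_periodic_AE_0:
  fixes f :: "point \<Rightarrow> real"
  assumes f: "continuous_on UNIV f" "doubly_periodic f" and z: "AE x in torus. f x = 0"
  shows "f x = 0"
proof -
  let ?Q = "{0<..<2*pi} \<times> {0<..<2*pi} :: point set"
  have Q: "f y = 0" if "y \<in> ?Q" for y
  proof (rule ccontr)
    assume "f y \<noteq> 0"
    define U where "U = ?Q \<inter> f -` (- {0})"
    have U: "open U" unfolding U_def
      using f(1) by (intro open_Int open_Times open_vimage) auto
    have "y \<in> U" using \<open>f y \<noteq> 0\<close> that by (simp add: U_def)
    have "AE x in lborel. x \<notin> U"
      using z unfolding AE_torus_iff by eventually_elim (auto simp: U_def)
    then have "U \<in> null_sets lborel" using U by (subst (asm) AE_iff_null_sets[symmetric]) auto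
    then have "U \<in> null_sets lebesgue" by (rule null_sets_completionI)
    then have "negligible U" by (simp add: negligible_iff_null_sets)
    then show False using U \<open>y \<in> U\<close> open_not_negligible by blast
  qed
  obtain y where y: "y \<in> cell" "f x = f y" using doubly_periodic_reduce[OF f(2)] .
  have "closure ?Q = {0..2*pi} \<times> {0..2*pi}" by (simp add: closure_Times)
  moreover have "y \<in> {0..2*pi} \<times> {0..2*pi}" using y(1) by (auto simp: mem_Times_iff)
  ultimately have "y \<in> closure ?Q" by simp
  note continuous_constant_on_closure[OF continuous_on_subset[OF f(1) subset_UNIV] Q this]
  then show ?thesis using y(2) by simp
qed

lemma integrable_torus_continuous_periodic:
  fixes f :: "point \<Rightarrow> real"
  assumes "continuous_on UNIV f" "doubly_periodic f"
  shows "integrable torus f"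
proof -
  obtain B where "\<And>x. \<bar>f x\<bar> \<le> B" using continuous_periodic_bounded[OF assms] by metis
  then show ?thesis
    using borel_measurable_continuous_onI[OF assms(1)] by (intro torus.integrable_const_bound[of _ B]) auto
qed

lemma fcoef_diff:
  assumes "integrable torus f" "integrable torus g"
  shows "fcoef (\<lambda>x. f x - g x) k = fcoef f k - fcoef g k"
proof -
  have i: "integrable torus (\<lambda>x. complex_of_real (f x) * cis (- (kvec k \<bullet> x)))" if "integrable torus f" for f
    using that by (intro integrable_torus_mult_bounded[where B=1]) auto
  show ?thesis using i[OF assms(1)] i[OF assms(2)] by (simp add: fcoef_def left_diff_distrib)
qed

text \<open>This is the uniqueness half of the description by \<open>THE\<close> in
  \<open>X_field\<close>.\<close>

lemma continuous_periodic_fcoef_unique: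
  assumes f: "continuous_on UNIV f" "doubly_periodic f" and g: "continuous_on UNIV g" "doubly_periodic g"
    and eq: "\<And>k. fcoef f k = fcoef g k"
  shows "f = g"
proof
  fix x
  note i = integrable_torus_continuous_periodic[OF f] integrable_torus_continuous_periodic[OF g]
  have "f x - g x = 0"
  proof (rule continuous_periodic_AE_0[where f="\<lambda>x. f x - g x"])
    show "continuous_on UNIV (\<lambda>x. f x - g x)" using f g by (intro continuous_intros)
    show "doubly_periodic (\<lambda>x. f x - g x)" using f g by (simp add: doubly_periodic_def)
    show "AE x in torus. f x - g x = 0"
      using i eq by (intro fcoef_eq_0_imp_AE_0) (auto simp: fcoef_diff)
  qed
  then show "f x = g x" by simp
qed

section \<open>The weighted Sobolev norm\<close>

lemma L2_vec_norm_mono: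
  assumes "F \<in> borel_measurable M" "G \<in> L2_vec M" "0 \<le> c" "\<And>x. norm (F x) \<le> c * norm (G x)"
  shows "F \<in> L2_vec M" "L2_vec_norm M F \<le> c * L2_vec_norm M G"
proof -
  have le: "(norm (F x))\<^sup>2 \<le> c\<^sup>2 * (norm (G x))\<^sup>2" for x
    using assms(4) power_mono[OF assms(4) norm_ge_zero, of x 2] by (simp add: power_mult_distrib)
  have iG: "integrable M (\<lambda>x. c\<^sup>2 * (norm (G x))\<^sup>2)" using assms(2) by (auto simp: L2_vec_def)
  have "integrable M (\<lambda>x. (norm (F x))\<^sup>2)"
    by (rule Bochner_Integration.integrable_bound[OF iG]) (use assms(1) le in auto)
  then show "F \<in> L2_vec M" using assms(1) by (simp add: L2_vec_def)
  have "(\<integral>x. (norm (F x))\<^sup>2 \<partial>M) \<le> (\<integral>x. c\<^sup>2 * (norm (G x))\<^sup>2 \<partial>M)"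
    by (rule integral_mono) (fact+, rule le)
  then show "L2_vec_norm M F \<le> c * L2_vec_norm M G"
    using assms(3) by (simp add: L2_vec_norm_def real_sqrt_mult[symmetric] real_le_lsqrt power_mult_distrib)
qed

section \<open>Fourier coefficients of L2 functions and weak gradients\<close>

lemma L2_eq: "L2 = L2_vec torus"
proof -
  have "(borel_measurable torus :: (point \<Rightarrow> real) set) = borel_measurable borel"
    by (rule measurable_cong_sets) simp_all
  then show ?thesis by (simp add: L2_def L2_vec_def)
qed

lemma L2_integrable: "f \<in> L2 \<Longrightarrow> integrable torus f"
  unfolding L2_eq by (rule torus.L2_vec_integrable)

lemma integrable_mult_character:
  "integrable torus f \<Longrightarrow> integrable torus (\<lambda>x. complex_of_real (f x) * cis (- (kvec k \<bullet> x)))"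
  by (intro integrable_torus_mult_bounded[where B=1]) auto

lemma fcoef_add:
  "integrable torus f \<Longrightarrow> integrable torus g \<Longrightarrow> fcoef (\<lambda>x. f x + g x) k = fcoef f k + fcoef g k"
  by (simp add: fcoef_def distrib_right integrable_mult_character)

lemma fcoef_scale: "fcoef (\<lambda>x. c * f x) k = of_real c * fcoef f k"
  by (simp add: fcoef_def mult.assoc)

text \<open>Characters have modulus 1, so the L1 norm bounds each coefficient, and the L2 norm
  bounds the L1 norm. Fourier coefficients therefore pass to L2 limits.\<close>

lemma norm_fcoef_le: "f \<in> L2 \<Longrightarrow> cmod (fcoef f k) \<le> L2_vec_norm torus f"
proof -
  assume f: "f \<in> L2"
  have "cmod (fcoef f k) \<le> (\<integral>x. cmod (complex_of_real (f x) * cis (- (kvec k \<bullet> x))) \<partial>torus)"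
    unfolding fcoef_def by (rule integral_norm_bound)
  also have "\<dots> = (\<integral>x. norm (f x) \<partial>torus)" by (simp add: norm_mult)
  also have "\<dots> \<le> L2_vec_norm torus f" using f by (intro torus.integral_norm_le_L2_vec_norm) (simp add: L2_eq)
  finally show ?thesis .
qed

lemma fcoef_cong_AE:
  assumes "f \<in> borel_measurable borel" "g \<in> borel_measurable borel" "AE x in torus. f x = g x"
  shows "fcoef f k = fcoef g k"
  unfolding fcoef_def
proof (rule integral_cong_AE)
  show "AE x in torus. complex_of_real (f x) * cis (- (kvec k \<bullet> x)) = complex_of_real (g x) * cis (- (kvec k \<bullet> x))"
    using assms(3) by eventually_elim simp
qed (use assms in measurable)

lemma has_weak_gradient_add:
  assumes "v \<in> L2" "w \<in> L2" "has_weak_gradient v g" "has_weak_gradient w h"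
  shows "has_weak_gradient (\<lambda>x. v x + w x) (\<lambda>x. g x + h x)"
  using assms L2_vec_add[of "\<lambda>x. fst (g x)" torus "\<lambda>x. fst (h x)"]
    L2_vec_add[of "\<lambda>x. snd (g x)" torus "\<lambda>x. snd (h x)"]
  by (simp add: has_weak_gradient_def fcoef_add L2_integrable L2_eq distrib_left del: split_paired_All)

lemma has_weak_gradient_scale:
  assumes "has_weak_gradient v g"
  shows "has_weak_gradient (\<lambda>x. c * v x) (\<lambda>x. c *\<^sub>R g x)"
  using assms L2_vec_scale[of "\<lambda>x. fst (g x)" torus c] L2_vec_scale[of "\<lambda>x. snd (g x)" torus c]
  by (simp add: has_weak_gradient_def fcoef_scale L2_eq mult.left_commute del: split_paired_All)

lemma has_weak_gradient_diff:
  assumes "v \<in> L2" "w \<in> L2" "has_weak_gradient v g" "has_weak_gradient w h"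
  shows "has_weak_gradient (\<lambda>x. v x - w x) (\<lambda>x. g x - h x)"
  using has_weak_gradient_add[OF assms(1) _ assms(3) has_weak_gradient_scale[OF assms(4), of "-1"]]
    L2_vec_scale[of w torus "-1"] assms(2) by (simp add: L2_eq)

text \<open>The coefficients of v fix those of both gradient components, and coefficients determine
  an L2 function almost everywhere.\<close>

lemma has_weak_gradient_unique:
  assumes v: "v \<in> L2" "w \<in> L2" "AE x in torus. v x = w x"
    and g: "has_weak_gradient v g" and h: "has_weak_gradient w h"
  shows "AE x in torus. g x = h x"
proof -
  have eq: "fcoef v k = fcoef w k" for k
    using v by (intro fcoef_cong_AE) (auto simp: L2_def)
  have *: "AE x in torus. a x = b x" if "a \<in> L2" "b \<in> L2" "\<And>k. fcoef a k = fcoef b k" for a b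
  proof -
    have "AE x in torus. a x - b x = 0"
      using that by (intro fcoef_eq_0_imp_AE_0) (auto simp: fcoef_diff L2_integrable)
    then show ?thesis by eventually_elim simp
  qed
  have "AE x in torus. fst (g x) = fst (h x)" "AE x in torus. snd (g x) = snd (h x)"
    using g h eq by (auto intro!: * simp: has_weak_gradient_def)
  then show ?thesis by eventually_elim (simp add: prod_eq_iff)
qed

text \<open>The arbitrary choice made by \<open>SOME\<close> is thereby harmless: norms may be
  computed with any gradient at hand.\<close>

lemma weak_gradient_AE:
  assumes "v \<in> L2" "has_weak_gradient v g"
  shows "AE x in torus. weak_gradient v x = g x" "has_weak_gradient v (weak_gradient v)"
proof -
  show "has_weak_gradient v (weak_gradient v)"
    unfolding weak_gradient_def by (rule someI[of "has_weak_gradient v"]) fact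
  then show "AE x in torus. weak_gradient v x = g x"
    using assms by (intro has_weak_gradient_unique[of v v]) auto
qed

text \<open>The component \<open>exp (X x) * v x\<close> is added to the usual jet so that its plain
  L2 norm equals the form norm of \<open>exp (X x) * v x\<close> exactly, not just up to
  equivalence. As the jet is linear in the pair (v, g), the norm axioms are inherited from
  L2.\<close>

definition jet :: "(point \<Rightarrow> real) \<Rightarrow> (point \<Rightarrow> real) \<Rightarrow> (point \<Rightarrow> point) \<Rightarrow> point \<Rightarrow> real \<times> real \<times> point" where
  "jet X v g x = (exp (X x) * v x, v x, g x)"

lemma jet_add: "jet X (\<lambda>x. v x + w x) (\<lambda>x. g x + h x) x = jet X v g x + jet X w h x"
  by (simp add: jet_def distrib_left)

lemma jet_diff: "jet X (\<lambda>x. v x - w x) (\<lambda>x. g x - h x) x = jet X v g x - jet X w h x"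
  by (simp add: jet_def right_diff_distrib)

lemma jet_scale: "jet X (\<lambda>x. c * v x) (\<lambda>x. c *\<^sub>R g x) x = c *\<^sub>R jet X v g x"
  by (simp add: jet_def)

lemma L2_vec_pair:
  assumes "F \<in> L2_vec M" "G \<in> L2_vec M"
  shows "(\<lambda>x. (F x, G x)) \<in> L2_vec M"
  using assms by (auto simp: L2_vec_def norm_Pair)

lemma norm_fst_snd_le: "norm (fst z) \<le> norm z" "norm (snd z) \<le> norm z"
  using norm_fst_le[of "fst z" "snd z"] norm_snd_le[of "snd z" "fst z"] by simp_all

lemma
  fixes F :: "'a \<Rightarrow> 'b::euclidean_space \<times> 'c::euclidean_space"
  assumes "F \<in> L2_vec M"
  shows L2_vec_fst: "(\<lambda>x. fst (F x)) \<in> L2_vec M" and L2_vec_norm_fst: "L2_vec_norm M (\<lambda>x. fst (F x)) \<le> L2_vec_norm M F"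
    and L2_vec_snd: "(\<lambda>x. snd (F x)) \<in> L2_vec M" and L2_vec_norm_snd: "L2_vec_norm M (\<lambda>x. snd (F x)) \<le> L2_vec_norm M F"
proof -
  have [measurable]: "F \<in> borel_measurable M" using assms by (simp add: L2_vec_def)
  have m: "(\<lambda>x. fst (F x)) \<in> borel_measurable M" "(\<lambda>x. snd (F x)) \<in> borel_measurable M"
    by (rule borel_measurable_continuous_on[OF _ \<open>F \<in> borel_measurable M\<close>], intro continuous_intros)+
  show "(\<lambda>x. fst (F x)) \<in> L2_vec M" "L2_vec_norm M (\<lambda>x. fst (F x)) \<le> L2_vec_norm M F"
    using L2_vec_norm_mono[OF m(1) assms, of 1] norm_fst_snd_le(1)[of "F _"] by simp_all
  show "(\<lambda>x. snd (F x)) \<in> L2_vec M" "L2_vec_norm M (\<lambda>x. snd (F x)) \<le> L2_vec_norm M F"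
    using L2_vec_norm_mono[OF m(2) assms, of 1] norm_fst_snd_le(2)[of "F _"] by simp_all
qed

lemma has_weak_gradient_L2_vec: "has_weak_gradient v g \<Longrightarrow> g \<in> L2_vec torus"
  using L2_vec_pair[of "\<lambda>x. fst (g x)" torus "\<lambda>x. snd (g x)"]
  by (simp add: has_weak_gradient_def L2_eq)

section \<open>Completeness in the weighted norm\<close>

definition weighted_norm :: "(point \<Rightarrow> real) \<Rightarrow> (point \<Rightarrow> real) \<Rightarrow> real" where
  "weighted_norm X u = sqrt ((L2_norm u)\<^sup>2 + (H1_norm (\<lambda>x. exp (- X x) * u x))\<^sup>2)"

context
  fixes X :: "point \<Rightarrow> real"
  assumes X: "continuous_on UNIV X" "doubly_periodic X"
begin

abbreviation "wnorm \<equiv> weighted_norm X"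

lemma X_measurable [measurable]: "X \<in> borel_measurable borel"
  using X(1) by (rule borel_measurable_continuous_onI)

lemma exp_mult_L2:
  assumes "v \<in> L2" shows "(\<lambda>x. exp (X x) * v x) \<in> L2"
proof -
  obtain B where "\<And>x. \<bar>X x\<bar> \<le> B" using continuous_periodic_bounded[OF X] by metis
  then have B: "X x \<le> B" for x by (meson abs_le_D1)
  show ?thesis unfolding L2_eq
  proof (rule L2_vec_norm_mono(1))
    show v: "v \<in> L2_vec torus" using assms by (simp add: L2_eq)
    have [measurable]: "v \<in> borel_measurable borel" using assms by (simp add: L2_def)
    show "(\<lambda>x. exp (X x) * v x) \<in> borel_measurable torus" by measurable
    show "norm (exp (X x) * v x) \<le> exp B * norm (v x)" for x
      using B[of x] by (simp add: abs_mult mult_right_mono)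
  qed simp
qed

lemma jet_L2_vec: "v \<in> L2 \<Longrightarrow> has_weak_gradient v g \<Longrightarrow> jet X v g \<in> L2_vec torus"
  using exp_mult_L2[of v] unfolding jet_def[abs_def] L2_eq
  by (intro L2_vec_pair) (auto dest: has_weak_gradient_L2_vec)

lemma wnorm_eq_jet:
  assumes v: "v \<in> L2" and g: "has_weak_gradient v g"
  shows "wnorm (\<lambda>x. exp (X x) * v x) = L2_vec_norm torus (jet X v g)"
proof -
  have e: "exp (- X x) * (exp (X x) * v x) = v x" for x
    by (simp add: exp_minus)
  have gi: "g \<in> L2_vec torus" "weak_gradient v \<in> L2_vec torus"
    using g weak_gradient_AE[OF v g] by (auto intro: has_weak_gradient_L2_vec)
  have "(\<integral>x. (norm (weak_gradient v x))\<^sup>2 \<partial>torus) = (\<integral>x. (norm (g x))\<^sup>2 \<partial>torus)"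
    using L2_vec_norm_cong_AE[OF gi(2,1) weak_gradient_AE(1)[OF v g]] by (simp add: L2_vec_norm_def)
  moreover have "(\<integral>x. (norm (jet X v g x))\<^sup>2 \<partial>torus) =
      (\<integral>x. (exp (X x) * v x)\<^sup>2 \<partial>torus) + ((\<integral>x. (v x)\<^sup>2 \<partial>torus) + (\<integral>x. (norm (g x))\<^sup>2 \<partial>torus))"
    using v exp_mult_L2[OF v] gi(1) by (simp add: jet_def norm_Pair L2_def L2_vec_def)
  ultimately show ?thesis
    unfolding weighted_norm_def L2_norm_def H1_norm_def L2_vec_norm_def e by simp
qed

text \<open>All properties are transported through \<open>wnorm_eq_jet\<close>. For completeness,
  the jets converge in L2; the function and gradient parts of the limit are shown to form a jet
  again, and the first component is recovered from the boundedness of X.\<close>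

lemma complete_normed_exp_H1:
  "complete_normed {\<lambda>x. exp (X x) * v x | v. v \<in> H1} wnorm"
proof -
  let ?E = "\<lambda>v x. exp (X x) * v x"
  let ?D = "{?E v | v. v \<in> H1}"
  have DI: "?E v \<in> ?D" if "v \<in> L2" "has_weak_gradient v g" for v g
    using that by (auto simp: H1_def)
  have DE: "\<exists>v g. u = ?E v \<and> v \<in> L2 \<and> has_weak_gradient v g" if "u \<in> ?D" for u
    using that by (auto simp: H1_def)
  have add: "(\<lambda>x. v x + w x) \<in> L2" if "v \<in> L2" "w \<in> L2" for v w
    using L2_vec_add[of v torus w] that by (simp add: L2_eq)
  have diff: "(\<lambda>x. v x - w x) \<in> L2" if "v \<in> L2" "w \<in> L2" for v w
    using L2_vec_diff[of v torus w] that by (simp add: L2_eq)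
  have scale: "(\<lambda>x. c * v x) \<in> L2" if "v \<in> L2" for v c
    using L2_vec_scale[of v torus c] that by (simp add: L2_eq)
  have E_add: "(\<lambda>x. ?E v x + ?E w x) = ?E (\<lambda>x. v x + w x)" for v w by (simp add: distrib_left)
  have E_diff: "(\<lambda>x. ?E v x - ?E w x) = ?E (\<lambda>x. v x - w x)" for v w by (simp add: right_diff_distrib)
  have E_scale: "(\<lambda>x. c * ?E v x) = ?E (\<lambda>x. c * v x)" for v c by (simp add: mult.left_commute)
  have wdiff: "wnorm (\<lambda>x. ?E v x - ?E w x) = L2_vec_norm torus (\<lambda>x. jet X v g x - jet X w h x)"
    if "v \<in> L2" "has_weak_gradient v g" "w \<in> L2" "has_weak_gradient w h" for v w g h
    unfolding E_diff wnorm_eq_jet[OF diff[OF that(1,3)] has_weak_gradient_diff[OF that(1,3,2,4)]]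
    by (simp add: jet_diff L2_vec_norm_def)
  show ?thesis
    unfolding complete_normed_def
  proof (intro conjI ballI allI impI)
    have "has_weak_gradient (\<lambda>x. 0) (\<lambda>x. 0)" "(\<lambda>x. 0) \<in> L2"
      by (auto simp: has_weak_gradient_def L2_def fcoef_def)
    from DI[OF this(2,1)] show "(\<lambda>x. 0) \<in> ?D" by simp
  next
    fix u w assume "u \<in> ?D" "w \<in> ?D"
    from DE[OF this(1)] DE[OF this(2)]
    obtain v g v' g' where *: "u = ?E v" "v \<in> L2" "has_weak_gradient v g"
        "w = ?E v'" "v' \<in> L2" "has_weak_gradient v' g'" by blast
    note s = add[OF *(2,5)] has_weak_gradient_add[OF *(2,5,3,6)]
    show "(\<lambda>x. u x + w x) \<in> ?D"
      unfolding *(1,4) E_add using s by (rule DI)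
    have "wnorm (\<lambda>x. u x + w x) = L2_vec_norm torus (\<lambda>x. jet X v g x + jet X v' g' x)"
      unfolding *(1,4) E_add wnorm_eq_jet[OF s] by (simp add: jet_add L2_vec_norm_def)
    also have "\<dots> \<le> wnorm u + wnorm w"
      unfolding *(1,4) using * by (simp add: wnorm_eq_jet L2_vec_norm_triangle jet_L2_vec)
    finally show "wnorm (\<lambda>x. u x + w x) \<le> wnorm u + wnorm w" .
  next
    fix c u assume "u \<in> ?D"
    then obtain v g where *: "u = ?E v" "v \<in> L2" "has_weak_gradient v g" using DE by blast
    note s = scale[OF *(2)] has_weak_gradient_scale[OF *(3)]
    show "(\<lambda>x. c * u x) \<in> ?D"
      unfolding *(1) E_scale using s by (rule DI)
    have "wnorm (\<lambda>x. c * u x) = L2_vec_norm torus (\<lambda>x. c *\<^sub>R jet X v g x)"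
      unfolding *(1) E_scale wnorm_eq_jet[OF s] by (simp add: jet_scale L2_vec_norm_def)
    then show "wnorm (\<lambda>x. c * u x) = \<bar>c\<bar> * wnorm u"
      using * by (simp add: wnorm_eq_jet L2_vec_norm_scale)
  next
    fix u assume "u \<in> ?D"
    then obtain v g where *: "u = ?E v" "v \<in> L2" "has_weak_gradient v g" using DE by blast
    show "0 \<le> wnorm u" by (simp add: weighted_norm_def)
    \<comment> \<open>A function vanishing almost everywhere has a vanishing gradient, so the zero
      set of the norm is seen from \<open>v\<close> alone.\<close>
    have g0: "AE x in torus. g x = 0" if "AE x in torus. v x = 0"
    proof -
      have "has_weak_gradient (\<lambda>x. 0) (\<lambda>x. 0)" "(\<lambda>x. 0) \<in> L2"
        by (auto simp: has_weak_gradient_def L2_def fcoef_def)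
      with * that show ?thesis by (intro has_weak_gradient_unique[of v "\<lambda>x. 0"]) auto
    qed
    have "wnorm u = 0 \<longleftrightarrow> (AE x in torus. jet X v g x = 0)"
      using * by (simp add: wnorm_eq_jet L2_vec_norm_eq_0_iff jet_L2_vec)
    also have "\<dots> \<longleftrightarrow> (AE x in torus. v x = 0 \<and> g x = 0)"
      by (simp add: jet_def prod_eq_iff zero_prod_def[symmetric])
    also have "\<dots> \<longleftrightarrow> (AE x in torus. v x = 0)"
    proof
      assume v0: "AE x in torus. v x = 0"
      from v0 g0[OF v0] show "AE x in torus. v x = 0 \<and> g x = 0" by eventually_elim simp
    qed (erule AE_mp, simp)
    also have "\<dots> \<longleftrightarrow> (AE x in torus. u x = 0)" by (simp add: *(1))
    finally show "wnorm u = 0 \<longleftrightarrow> (AE x in torus. u x = 0)" .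
  next
    fix u :: "nat \<Rightarrow> point \<Rightarrow> real"
    assume u: "(\<forall>n. u n \<in> ?D) \<and> (\<forall>e>0. \<exists>n0. \<forall>m\<ge>n0. \<forall>n\<ge>n0. wnorm (\<lambda>x. u m x - u n x) < e)"
    then have "u n \<in> ?D" for n by blast
    \<comment> \<open>Function and gradient are chosen together as one pair for each index.\<close>
    from DE[OF this] have "\<forall>n. \<exists>p. u n = ?E (fst p) \<and> fst p \<in> L2 \<and> has_weak_gradient (fst p) (snd p)" by simp
    from choice[OF this] obtain p where p: "\<forall>n. u n = ?E (fst (p n)) \<and> fst (p n) \<in> L2 \<and> has_weak_gradient (fst (p n)) (snd (p n))" ..
    define v where "v n = fst (p n)" for n
    define g where "g n = snd (p n)" for n
    have u_eq: "u n = ?E (v n)" and v: "v n \<in> L2" and g: "has_weak_gradient (v n) (g n)" for n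
      using p by (auto simp: v_def g_def)
    obtain F where F: "F \<in> L2_vec torus" "(\<lambda>n. L2_vec_norm torus (\<lambda>x. jet X (v n) (g n) x - F x)) \<longlonglongrightarrow> 0"
    proof (rule torus.L2_vec_norm_complete[of "\<lambda>n. jet X (v n) (g n)"])
      show "jet X (v n) (g n) \<in> L2_vec torus" for n using v g by (rule jet_L2_vec)
      show "\<exists>n0. \<forall>m\<ge>n0. \<forall>n\<ge>n0. L2_vec_norm torus (\<lambda>x. jet X (v m) (g m) x - jet X (v n) (g n) x) < e" if "0 < e" for e
        using u that by (simp add: u_eq wdiff[OF v g v g])
    qed
    define v' where "v' x = fst (snd (F x))" for x
    define g' where "g' x = snd (snd (F x))" for x
    have v': "v' \<in> L2" and g'L: "g' \<in> L2_vec torus"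
      unfolding v'_def g'_def L2_eq using F(1) by (intro L2_vec_fst L2_vec_snd; simp)+
    have d: "(\<lambda>x. jet X (v n) (g n) x - F x) \<in> L2_vec torus" for n
      using F(1) by (intro L2_vec_diff jet_L2_vec v g)
    \<comment> \<open>\<open>P\<close> stands for the coordinate projections, which are additive and
      do not increase the L2 norm.\<close>
    have lim_sub: "(\<lambda>n. L2_vec_norm torus (\<lambda>x. P (jet X (v n) (g n) x) - P (F x))) \<longlonglongrightarrow> 0"
      if "\<And>G. G \<in> L2_vec torus \<Longrightarrow> L2_vec_norm torus (\<lambda>x. P (G x)) \<le> L2_vec_norm torus G" "\<And>y z. P (y - z) = P y - P z"
      for P :: "real \<times> real \<times> point \<Rightarrow> 'c::euclidean_space"
      by (rule tendsto_sandwich[OF _ _ tendsto_const F(2)])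
        (use that(1)[OF d] in \<open>auto simp: that(2)[symmetric] intro!: always_eventually\<close>)
    have fc: "(\<lambda>n. fcoef (a n) k) \<longlonglongrightarrow> fcoef b k"
      if "\<And>n. a n \<in> L2" "b \<in> L2" "(\<lambda>n. L2_vec_norm torus (\<lambda>x. a n x - b x)) \<longlonglongrightarrow> 0" for a b k
    proof (rule LIM_zero_cancel, rule tendsto_norm_zero_cancel, rule tendsto_sandwich[OF _ _ tendsto_const that(3)])
      show "\<forall>\<^sub>F n in sequentially. cmod (fcoef (a n) k - fcoef b k) \<le> L2_vec_norm torus (\<lambda>x. a n x - b x)"
        using norm_fcoef_le[OF diff[OF that(1,2)]] fcoef_diff[OF L2_integrable[OF that(1)] L2_integrable[OF that(2)]]
        by auto
    qed auto
    have snd2: "L2_vec_norm torus (\<lambda>x. snd (snd (G x))) \<le> L2_vec_norm torus G" if "G \<in> L2_vec torus" for G :: "point \<Rightarrow> real \<times> real \<times> point"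
      using L2_vec_norm_snd[OF that] L2_vec_norm_snd[OF L2_vec_snd[OF that]] by simp
    have vl: "(\<lambda>n. fcoef (v n) k) \<longlonglongrightarrow> fcoef v' k" for k
    proof (rule fc[OF v v'])
      show "(\<lambda>n. L2_vec_norm torus (\<lambda>x. v n x - v' x)) \<longlonglongrightarrow> 0"
        using lim_sub[of "\<lambda>y. fst (snd y)", OF order_trans[OF L2_vec_norm_fst[OF L2_vec_snd] L2_vec_norm_snd]]
        by (simp add: jet_def v'_def)
    qed
    have gL: "(\<lambda>x. fst (g n x)) \<in> L2" "(\<lambda>x. snd (g n x)) \<in> L2" for n using g by (auto simp: has_weak_gradient_def)
    have g'L2: "(\<lambda>x. fst (g' x)) \<in> L2" "(\<lambda>x. snd (g' x)) \<in> L2" using g'L by (auto simp: L2_eq intro: L2_vec_fst L2_vec_snd)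
    have g1: "(\<lambda>n. fcoef (\<lambda>x. fst (g n x)) k) \<longlonglongrightarrow> fcoef (\<lambda>x. fst (g' x)) k" for k
    proof (rule fc[OF gL(1) g'L2(1)])
      show "(\<lambda>n. L2_vec_norm torus (\<lambda>x. fst (g n x) - fst (g' x))) \<longlonglongrightarrow> 0"
        using lim_sub[of "\<lambda>y. fst (snd (snd y))", OF order_trans[OF L2_vec_norm_fst[OF L2_vec_snd[OF L2_vec_snd]] snd2]]
        by (simp add: jet_def g'_def)
    qed
    have g2: "(\<lambda>n. fcoef (\<lambda>x. snd (g n x)) k) \<longlonglongrightarrow> fcoef (\<lambda>x. snd (g' x)) k" for k
    proof (rule fc[OF gL(2) g'L2(2)])
      show "(\<lambda>n. L2_vec_norm torus (\<lambda>x. snd (g n x) - snd (g' x))) \<longlonglongrightarrow> 0"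
        using lim_sub[of "\<lambda>y. snd (snd (snd y))", OF order_trans[OF L2_vec_norm_snd[OF L2_vec_snd[OF L2_vec_snd]] snd2]]
        by (simp add: jet_def g'_def)
    qed
    \<comment> \<open>For each fixed frequency the identity defining the weak gradient passes to the
      limit.\<close>
    have grad: "has_weak_gradient v' g'"
      unfolding has_weak_gradient_def
    proof (intro conjI allI g'L2)
      fix k
      have "(\<lambda>n. \<i> * of_int (fst k) * fcoef (v n) k) \<longlonglongrightarrow> \<i> * of_int (fst k) * fcoef v' k"
        by (intro tendsto_intros vl)
      moreover have "fcoef (\<lambda>x. fst (g n x)) k = \<i> * of_int (fst k) * fcoef (v n) k" for n
        using g[of n] unfolding has_weak_gradient_def by blast
      ultimately show "fcoef (\<lambda>x. fst (g' x)) k = \<i> * of_int (fst k) * fcoef v' k"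
        using g1[of k] by (simp only:) (rule LIMSEQ_unique)
      have "(\<lambda>n. \<i> * of_int (snd k) * fcoef (v n) k) \<longlonglongrightarrow> \<i> * of_int (snd k) * fcoef v' k"
        by (intro tendsto_intros vl)
      moreover have "fcoef (\<lambda>x. snd (g n x)) k = \<i> * of_int (snd k) * fcoef (v n) k" for n
        using g[of n] unfolding has_weak_gradient_def by blast
      ultimately show "fcoef (\<lambda>x. snd (g' x)) k = \<i> * of_int (snd k) * fcoef v' k"
        using g2[of k] by (simp only:) (rule LIMSEQ_unique)
    qed
    obtain B where B: "\<And>x. \<bar>X x\<bar> \<le> B" using continuous_periodic_bounded[OF X] by metis
    \<comment> \<open>The first component of the difference is at most \<open>exp B\<close> times
      the norm of the other two, and those are components of the difference with
      \<open>F\<close>.\<close>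
    have jl: "L2_vec_norm torus (\<lambda>x. jet X (v n) (g n) x - jet X v' g' x)
        \<le> (exp B + 1) * L2_vec_norm torus (\<lambda>x. jet X (v n) (g n) x - F x)" for n
    proof (rule L2_vec_norm_mono(2)[OF _ d])
      show "(\<lambda>x. jet X (v n) (g n) x - jet X v' g' x) \<in> borel_measurable torus"
        using L2_vec_diff[OF jet_L2_vec[OF v g] jet_L2_vec[OF v' grad], of n] by (simp add: L2_vec_def)
      show "norm (jet X (v n) (g n) x - jet X v' g' x) \<le> (exp B + 1) * norm (jet X (v n) (g n) x - F x)" for x
      proof -
        let ?y = "(v n x - v' x, g n x - g' x)"
        have "jet X (v n) (g n) x - jet X v' g' x = (exp (X x) * (v n x - v' x), ?y)"
          by (simp add: jet_def right_diff_distrib)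
        then have "norm (jet X (v n) (g n) x - jet X v' g' x) \<le> norm (exp (X x) * (v n x - v' x)) + norm ?y"
          by (metis norm_Pair_le)
        also have "norm (exp (X x) * (v n x - v' x)) \<le> exp B * norm ?y"
          using B[of x] norm_fst_le[of "v n x - v' x" "g n x - g' x"]
          by (auto simp: abs_mult intro!: mult_mono)
        also have "?y = snd (jet X (v n) (g n) x - F x)" by (simp add: jet_def v'_def g'_def prod_eq_iff)
        also have "exp B * norm (snd (jet X (v n) (g n) x - F x)) + norm (snd (jet X (v n) (g n) x - F x))
            \<le> (exp B + 1) * norm (jet X (v n) (g n) x - F x)"
          unfolding distrib_right mult_1
          by (intro add_mono mult_left_mono norm_fst_snd_le exp_ge_zero)
        finally show ?thesis by simp
      qed
    qed simp
    have "(\<lambda>n. wnorm (\<lambda>x. u n x - ?E v' x)) \<longlonglongrightarrow> 0"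
    proof (rule tendsto_sandwich[OF _ _ tendsto_const])
      show "\<forall>\<^sub>F n in sequentially. wnorm (\<lambda>x. u n x - ?E v' x)
          \<le> (exp B + 1) * L2_vec_norm torus (\<lambda>x. jet X (v n) (g n) x - F x)"
        using jl by (simp add: u_eq wdiff[OF v g v' grad])
      show "(\<lambda>n. (exp B + 1) * L2_vec_norm torus (\<lambda>x. jet X (v n) (g n) x - F x)) \<longlonglongrightarrow> 0"
        using tendsto_mult_left[OF F(2), of "exp B + 1"] by simp
    qed (auto simp: weighted_norm_def)
    then show "\<exists>l\<in>?D. (\<lambda>n. wnorm (\<lambda>x. u n x - l x)) \<longlonglongrightarrow> 0"
      by (intro bexI[of _ "?E v'"] DI[OF v' grad])
  qed
qed

end

lemma closed_form_anderson:
  assumes "continuous_on UNIV (X_field \<xi> \<omega>)" "doubly_periodic (X_field \<xi> \<omega>)"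
  shows "closed_form (anderson_form M \<xi> \<rho> \<theta> \<phi> \<omega>)"
proof -
  have "form_norm (anderson_form M \<xi> \<rho> \<theta> \<phi> \<omega>) = weighted_norm (X_field \<xi> \<omega>)"
    by (rule ext) (simp add: anderson_form_def weighted_norm_def)
  moreover have "form_dom (anderson_form M \<xi> \<rho> \<theta> \<phi> \<omega>) = {\<lambda>x. exp (X_field \<xi> \<omega> x) * v x | v. v \<in> H1}"
    by (simp add: anderson_form_def)
  moreover have "{\<lambda>x. exp (X_field \<xi> \<omega> x) * v x | v. v \<in> H1} \<subseteq> L2"
    using exp_mult_L2[OF assms] unfolding H1_def by blast
  ultimately show ?thesis
    using complete_normed_exp_H1[OF assms] by (simp only: closed_form_def simp_thms)
qed

section \<open>Dyadic trigonometric sums\<close>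

text \<open>The maximum norm makes the dyadic shells subsets of squares, whose lattice points are
  easily counted. The frequency 0 also gets level 0, which is why \<open>dyadic_block\<close>
  excludes it explicitly.\<close>

definition level :: "freq \<Rightarrow> nat" where
  "level k = (LEAST n. max \<bar>fst k\<bar> \<bar>snd k\<bar> < 2 ^ (n + 1))"

definition dyadic_block :: "nat \<Rightarrow> freq set" where
  "dyadic_block n = {k \<in> half_lattice. k \<noteq> 0 \<and> level k = n}"

lemma level_bounds:
  assumes "k \<noteq> 0"
  shows "2 ^ level k \<le> max \<bar>fst k\<bar> \<bar>snd k\<bar>" "max \<bar>fst k\<bar> \<bar>snd k\<bar> < 2 ^ (level k + 1)"
proof -
  let ?m = "max \<bar>fst k\<bar> \<bar>snd k\<bar>"
  have m: "1 \<le> ?m" using assms by (auto simp: prod_eq_iff max_def)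
  then have "1 \<le> nat ?m" by linarith
  then obtain n where "2 ^ n \<le> nat ?m" "nat ?m < 2 ^ (n + 1)" using ex_power_ivl1[of 2 "nat ?m"] by auto
  moreover have "int (nat ?m) = ?m" using m by simp
  ultimately have "?m < 2 ^ (n + 1)" by (metis of_nat_less_iff of_nat_numeral of_nat_power)
  then show u: "?m < 2 ^ (level k + 1)" unfolding level_def by (rule LeastI)
  show "2 ^ level k \<le> ?m"
  proof (cases "level k")
    case 0
    then show ?thesis using m by simp
  next
    case (Suc j)
    then have "\<not> ?m < 2 ^ (j + 1)"
      unfolding level_def by (metis lessI not_less_Least)
    then show ?thesis using Suc by (simp add: max_def)
  qed
qed

lemma level_minus [simp]: "level (- k) = level k"
  by (simp add: level_def)

lemma half_lattice_cases: "k \<noteq> 0 \<Longrightarrow> k \<in> half_lattice \<longleftrightarrow> - k \<notin> half_lattice"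
  by (auto simp: half_lattice_def prod_eq_iff)

lemma dyadic_block_subset: "dyadic_block n \<subseteq> {- (2 ^ (n + 1))..<2 ^ (n + 1)} \<times> {- (2 ^ (n + 1))..<2 ^ (n + 1)}"
proof
  fix k assume "k \<in> dyadic_block n"
  then have "max \<bar>fst k\<bar> \<bar>snd k\<bar> < 2 ^ (n + 1)"
    using level_bounds(2)[of k] by (auto simp: dyadic_block_def)
  then show "k \<in> {- (2 ^ (n + 1))..<2 ^ (n + 1)} \<times> {- (2 ^ (n + 1))..<2 ^ (n + 1)}"
    by (auto simp: mem_Times_iff)
qed

lemma card_square: "card ({- (2 ^ n)..<2 ^ n} \<times> {- (2 ^ n)..<2 ^ n} :: freq set) = 4 ^ (n + 1)"
proof -
  have "nat (2 ^ n + 2 ^ n) = 2 ^ (n + 1)" by (simp add: nat_mult_distrib nat_power_eq flip: mult_2)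
  moreover have "(2 :: nat) ^ (n + 1) * 2 ^ (n + 1) = 4 ^ (n + 1)" by (simp flip: power_mult_distrib)
  ultimately show ?thesis by (simp add: card_cartesian_product)
qed

lemma finite_dyadic_block [simp]: "finite (dyadic_block n)"
  by (rule finite_subset[OF dyadic_block_subset]) simp

lemma card_dyadic_block: "card (dyadic_block n) \<le> 4 ^ (n + 2)"
  using card_mono[OF _ dyadic_block_subset, of n] card_square[of "n + 1"] by simp

text \<open>The Euclidean norm dominates the maximum norm, which is at least \<open>2 ^ n\<close> on
  the block.\<close>

lemma norm_kvec_dyadic_block:
  assumes "k \<in> dyadic_block n" shows "4 ^ n \<le> (norm (kvec k))\<^sup>2"
proof -
  have "k \<noteq> 0" "level k = n" using assms by (auto simp: dyadic_block_def)
  then have "2 ^ n \<le> max \<bar>fst k\<bar> \<bar>snd k\<bar>" using level_bounds(1) by blast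
  then have "(2 ^ n)\<^sup>2 \<le> (max \<bar>fst k\<bar> \<bar>snd k\<bar>)\<^sup>2" by (intro power_mono) auto
  also have "\<dots> \<le> (fst k)\<^sup>2 + (snd k)\<^sup>2" by (auto simp: max_def)
  finally have "real_of_int ((2 ^ n)\<^sup>2) \<le> of_int ((fst k)\<^sup>2 + (snd k)\<^sup>2)" by (simp only: of_int_le_iff)
  moreover have "(2 ^ n)\<^sup>2 = (4 ^ n :: real)" by (simp add: power2_eq_square flip: power_mult_distrib)
  ultimately show ?thesis by (simp add: kvec_def norm_Pair)
qed

lemma kvec_diff: "kvec (k - l) = kvec k - kvec l"
  by (simp add: kvec_def)

section \<open>Trigonometric sums and their uniform summation\<close>

definition trig_sum :: "freq set \<Rightarrow> (freq \<Rightarrow> complex) \<Rightarrow> point \<Rightarrow> complex" where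
  "trig_sum B z x = (\<Sum>k\<in>B. z k * cis (kvec k \<bullet> x))"

text \<open>Twice the real part is the sum plus its conjugate, and the conjugate carries the
  frequencies -l; orthogonality of the characters does the rest.\<close>

lemma fcoef_re_trig_sum:
  assumes B: "finite B"
  shows "fcoef (\<lambda>x. 2 * Re (trig_sum B z x)) k =
    (if k \<in> B then z k else 0) + (if - k \<in> B then cnj (z (- k)) else 0)"
proof -
  have re: "complex_of_real (2 * Re w) = w + cnj w" for w by (simp add: complex_add_cnj)
  have c: "cis (kvec l \<bullet> x) * cis (- (kvec k \<bullet> x)) = cis (kvec (l - k) \<bullet> x)"
    "cis (- (kvec l \<bullet> x)) * cis (- (kvec k \<bullet> x)) = cis (kvec (- l - k) \<bullet> x)" for l x
    by (simp_all add: cis_mult kvec_diff kvec_minus inner_diff_left)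
  have "complex_of_real (2 * Re (trig_sum B z x)) * cis (- (kvec k \<bullet> x)) =
     (\<Sum>l\<in>B. z l * cis (kvec (l - k) \<bullet> x)) + (\<Sum>l\<in>B. cnj (z l) * cis (kvec (- l - k) \<bullet> x))" for x
    unfolding re trig_sum_def distrib_right sum_distrib_right cnj_sum complex_cnj_mult cis_cnj mult.assoc c ..
  moreover have i: "integrable torus (\<lambda>x. cis (kvec m \<bullet> x))" for m
    by (rule torus.integrable_const_bound[of _ 1]) auto
  ultimately have "fcoef (\<lambda>x. 2 * Re (trig_sum B z x)) k =
     (\<Sum>l\<in>B. z l * (if l - k = 0 then 1 else 0)) + (\<Sum>l\<in>B. cnj (z l) * (if - l - k = 0 then 1 else 0))"
    unfolding fcoef_def by (simp add: integral_torus_character)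
  also have "(\<Sum>l\<in>B. z l * (if l - k = 0 then 1 else 0)) = (if k \<in> B then z k else 0)"
    using B by (simp add: if_distrib[of "\<lambda>y. _ * y"] cong: if_cong)
  also have "(\<Sum>l\<in>B. cnj (z l) * (if - l - k = 0 then 1 else 0)) = (\<Sum>l\<in>B. if l = - k then cnj (z l) else 0)"
  proof -
    have "- l - k = 0 \<longleftrightarrow> l = - k" for l by (auto simp: prod_eq_iff)
    then show ?thesis by (simp add: if_distrib[of "\<lambda>y. _ * y"] cong: if_cong)
  qed
  also have "\<dots> = (if - k \<in> B then cnj (z (- k)) else 0)" using B by simp
  finally show ?thesis .
qed

lemma continuous_trig_sum [continuous_intros]: "continuous_on S (trig_sum B z)"
  unfolding trig_sum_def by (intro continuous_intros)

lemma doubly_periodic_trig_sum: "doubly_periodic (trig_sum B z)"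
proof -
  have "cis (kvec k \<bullet> (x + 2*pi, y)) = cis (kvec k \<bullet> (x, y)) * cis (2 * pi * of_int (fst k))"
       "cis (kvec k \<bullet> (x, y + 2*pi)) = cis (kvec k \<bullet> (x, y)) * cis (2 * pi * of_int (snd k))" for k x y
    by (simp_all add: kvec_inner cis_mult algebra_simps)
  then show ?thesis by (simp add: doubly_periodic_def trig_sum_def)
qed

text \<open>The Weierstrass M-test gives a uniform, hence continuous, limit. The same majorant
  permits integration term by term, so the coefficients of the limit are those of the
  blocks.\<close>

lemma continuous_function_of_blocks:
  assumes z0: "z 0 = 0" and zm: "\<And>k. z (- k) = cnj (z k)"
    and b: "summable b" "\<And>n x. cmod (trig_sum (dyadic_block n) z x) \<le> b n"
  shows "\<exists>f. continuous_on UNIV f \<and> doubly_periodic f \<and> (\<forall>k. fcoef f k = z k)"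
proof -
  let ?P = "\<lambda>n x. 2 * Re (trig_sum (dyadic_block n) z x)"
  define f where "f x = (\<Sum>n. ?P n x)" for x
  have bnd: "\<bar>?P n x\<bar> \<le> 2 * b n" for n x
    using order_trans[OF abs_Re_le_cmod b(2), of n x] by simp
  have sb: "summable (\<lambda>n. 2 * b n)" using b(1) by (rule summable_mult)
  have unif: "uniform_limit UNIV (\<lambda>n x. \<Sum>i<n. ?P i x) f sequentially"
    unfolding f_def by (rule Weierstrass_m_test[OF _ sb]) (simp add: bnd del: abs_mult)
  have "continuous_on UNIV f"
    by (rule uniform_limit_theorem[OF _ unif]) (auto intro!: always_eventually continuous_intros)
  moreover have "doubly_periodic f"
    using doubly_periodic_trig_sum by (simp add: f_def doubly_periodic_def)
  moreover have "fcoef f k = z k" for k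
  proof -
    let ?g = "\<lambda>n x. complex_of_real (?P n x) * cis (- (kvec k \<bullet> x))"
    have gb: "cmod (?g n x) \<le> 2 * b n" for n x
      using bnd[of n x] by (simp add: norm_mult)
    have gi: "integrable torus (?g n)" for n
    proof (rule torus.integrable_const_bound[of _ "2 * b n"])
      show "AE x in torus. cmod (?g n x) \<le> 2 * b n" by (intro AE_I2 gb)
      have "?g n \<in> borel_measurable borel"
        by (intro borel_measurable_continuous_onI continuous_intros)
      then show "?g n \<in> borel_measurable torus" by measurable
    qed
    have sP: "summable (\<lambda>n. ?P n x)" for x
      by (rule summable_comparison_test'[OF sb]) (simp add: bnd del: abs_mult)
    have "(\<lambda>n. integral\<^sup>L torus (?g n)) sums (\<integral>x. (\<Sum>n. ?g n x) \<partial>torus)"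
    proof (rule sums_integral[OF gi])
      show "AE x in torus. summable (\<lambda>i. cmod (?g i x))"
        by (intro AE_I2 summable_comparison_test'[OF sb, of 0]) (simp only: real_norm_def abs_norm_cancel gb)
      have "(\<integral>x. cmod (?g i x) \<partial>torus) \<le> 2 * b i" for i
        using torus.integral_le_const[of "\<lambda>x. cmod (?g i x)" "2 * b i"] gi gb by auto
      then show "summable (\<lambda>i. \<integral>x. cmod (?g i x) \<partial>torus)"
        by (intro summable_comparison_test'[OF sb, of 0]) (simp del: norm_mult)
    qed
    also have "(\<lambda>x. \<Sum>n. ?g n x) = (\<lambda>x. complex_of_real (f x) * cis (- (kvec k \<bullet> x)))"
      by (simp only: suminf_mult2[OF summable_of_real[OF sP], symmetric] suminf_of_real[OF sP, symmetric] f_def)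
    finally have "(\<lambda>n. fcoef (?P n) k) sums fcoef f k" by (simp only: fcoef_def)
    \<comment> \<open>For nonzero k exactly one of k and -k lies in the half lattice, and both have
      the same level. The single contributing block yields \<open>z k\<close> directly or as the
      conjugate of \<open>z (- k)\<close>; for k = 0 both sides vanish.\<close>
    moreover have "fcoef (?P n) k = (if n = level k then z k else 0)" for n
      unfolding fcoef_re_trig_sum[OF finite_dyadic_block]
      using half_lattice_cases[of k] z0 zm[of k] by (cases "k = 0") (auto simp: dyadic_block_def)
    ultimately show ?thesis using sums_single[of "level k" "\<lambda>_. z k"] sums_unique2
      by (simp only:) blast
  qed
  ultimately show ?thesis by blast
qed

section \<open>Fourth moments of the dyadic blocks\<close>

text \<open>A crude bound, by applying the arithmetic-geometric mean inequality twice; it serves as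
  an integrable majorant.\<close>

lemma cmod_mult4_le:
  "cmod (a * b * cnj (c * d)) \<le> cmod a ^ 4 + cmod b ^ 4 + cmod c ^ 4 + cmod d ^ 4"
proof -
  have am: "x * y \<le> (x\<^sup>2 + y\<^sup>2) / 2" for x y :: real
    using sum_squares_bound[of x y] by (simp add: field_simps)
  have p4: "x ^ 4 = (x\<^sup>2)\<^sup>2" for x :: real by simp
  have "cmod (a * b * cnj (c * d)) = (cmod a * cmod b) * (cmod c * cmod d)" by (simp add: norm_mult)
  also have "\<dots> \<le> ((cmod a * cmod b)\<^sup>2 + (cmod c * cmod d)\<^sup>2) / 2" by (rule am)
  also have "\<dots> \<le> (((cmod a) ^ 4 + (cmod b) ^ 4) / 2 + ((cmod c) ^ 4 + (cmod d) ^ 4) / 2) / 2"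
    unfolding p4 power_mult_distrib by (intro divide_right_mono add_mono am) simp
  also have "\<dots> \<le> cmod a ^ 4 + cmod b ^ 4 + cmod c ^ 4 + cmod d ^ 4"
  proof -
    have "0 \<le> cmod a ^ 4" "0 \<le> cmod b ^ 4" "0 \<le> cmod c ^ 4" "0 \<le> cmod d ^ 4" by simp_all
    then show ?thesis by argo
  qed
  finally show ?thesis .
qed

text \<open>Here the factor 1/2 is kept, so that a fourth moment bound K for both factors gives the
  bound K for the product.\<close>

lemma cmod_mult2_le: "(cmod (a * b))\<^sup>2 \<le> (cmod a ^ 4 + cmod b ^ 4) / 2"
proof -
  have "(cmod (a * b))\<^sup>2 = (cmod a)\<^sup>2 * (cmod b)\<^sup>2" by (simp add: norm_mult power_mult_distrib)
  also have "\<dots> \<le> (((cmod a)\<^sup>2)\<^sup>2 + ((cmod b)\<^sup>2)\<^sup>2) / 2"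
    using sum_squares_bound[of "(cmod a)\<^sup>2" "(cmod b)\<^sup>2"] by (simp add: field_simps)
  finally show ?thesis by simp
qed

section \<open>The square of a trigonometric sum\<close>

definition pairs_with_sum :: "freq set \<Rightarrow> freq \<Rightarrow> (freq \<times> freq) set" where
  "pairs_with_sum B m = {p \<in> B \<times> B. fst p + snd p = m}"

definition square_coef :: "freq set \<Rightarrow> (freq \<Rightarrow> complex) \<Rightarrow> freq \<Rightarrow> complex" where
  "square_coef B z m = (\<Sum>p\<in>pairs_with_sum B m. z (fst p) * z (snd p))"

definition sumset :: "freq set \<Rightarrow> freq set" where
  "sumset B = (\<lambda>p. fst p + snd p) ` (B \<times> B)"

lemma trig_sum_square:
  assumes "finite B"
  shows "(trig_sum B z x)\<^sup>2 = (\<Sum>m\<in>sumset B. square_coef B z m * cis (kvec m \<bullet> x))"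
proof -
  have "(trig_sum B z x)\<^sup>2 = (\<Sum>p\<in>B \<times> B. z (fst p) * z (snd p) * cis (kvec (fst p + snd p) \<bullet> x))"
    by (simp add: power2_eq_square trig_sum_def sum_product sum.cartesian_product kvec_add inner_add_left
        case_prod_beta flip: cis_mult) (simp add: mult_ac)
  also have "\<dots> = (\<Sum>m\<in>sumset B. \<Sum>p\<in>{p \<in> B \<times> B. fst p + snd p = m}. z (fst p) * z (snd p) * cis (kvec (fst p + snd p) \<bullet> x))"
    unfolding sumset_def using assms by (subst sum.image_gen[where g="\<lambda>p. fst p + snd p"]) auto
  also have "\<dots> = (\<Sum>m\<in>sumset B. square_coef B z m * cis (kvec m \<bullet> x))"
    by (simp add: square_coef_def pairs_with_sum_def sum_distrib_right)
  finally show ?thesis .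
qed

text \<open>The modulus of the squared sum is at most the l1 norm of its coefficients, uniformly in
  x. Cauchy-Schwarz against the constant 1 turns this into their l2 norm at the price of the number
  of frequencies.\<close>

lemma trig_sum_power4_le:
  assumes "finite B"
  shows "(cmod (trig_sum B z x)) ^ 4 \<le> card (sumset B) * (\<Sum>m\<in>sumset B. (cmod (square_coef B z m))\<^sup>2)"
proof -
  have "(cmod (trig_sum B z x))\<^sup>2 \<le> (\<Sum>m\<in>sumset B. cmod (square_coef B z m))"
    unfolding norm_power[symmetric] trig_sum_square[OF assms]
    by (rule order_trans[OF norm_sum]) (simp add: norm_mult)
  then have "((cmod (trig_sum B z x))\<^sup>2)\<^sup>2 \<le> (\<Sum>m\<in>sumset B. cmod (square_coef B z m))\<^sup>2"
    by (intro power_mono) auto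
  also have "\<dots> \<le> (\<Sum>m\<in>sumset B. (1::real)\<^sup>2) * (\<Sum>m\<in>sumset B. (cmod (square_coef B z m))\<^sup>2)"
    using Cauchy_Schwarz_ineq_sum[of "\<lambda>_. 1" "\<lambda>m. cmod (square_coef B z m)" "sumset B"] by simp
  finally show ?thesis by simp
qed

text \<open>Expanding |D_m|^2 gives a double sum over pairs p, q with the same sum m. Two such pairs
  sharing an entry are equal up to order, and all others are orthogonal; so each p keeps at most two
  terms, each bounded by \<open>s ^ 4 * K\<close>.\<close>

lemma (in prob_space) expectation_square_coef_le:
  fixes \<xi> :: "freq \<Rightarrow> 'a \<Rightarrow> complex" and c :: "freq \<Rightarrow> real"
  assumes B: "finite B"
    and [measurable]: "\<And>k. \<xi> k \<in> borel_measurable M"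
    and i4: "\<And>k. k \<in> B \<Longrightarrow> integrable M (\<lambda>\<omega>. cmod (\<xi> k \<omega>) ^ 4)"
    and K: "\<And>k. k \<in> B \<Longrightarrow> (\<integral>\<omega>. cmod (\<xi> k \<omega>) ^ 4 \<partial>M) \<le> K"
    and c: "\<And>k. k \<in> B \<Longrightarrow> \<bar>c k\<bar> \<le> s"
    and orth: "\<And>k l k' l'. k \<in> B \<Longrightarrow> l \<in> B \<Longrightarrow> k' \<in> B \<Longrightarrow> l' \<in> B \<Longrightarrow> {k, l} \<inter> {k', l'} = {} \<Longrightarrow>
      (\<integral>\<omega>. \<xi> k \<omega> * \<xi> l \<omega> * cnj (\<xi> k' \<omega> * \<xi> l' \<omega>) \<partial>M) = 0"
  defines "D \<equiv> \<lambda>m \<omega>. square_coef B (\<lambda>k. of_real (c k) * \<xi> k \<omega>) m"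
  shows "integrable M (\<lambda>\<omega>. (cmod (D m \<omega>))\<^sup>2)"
    and "(\<integral>\<omega>. (cmod (D m \<omega>))\<^sup>2 \<partial>M) \<le> 2 * K * s ^ 4 * card (pairs_with_sum B m)"
proof -
  let ?P = "pairs_with_sum B m"
  define Z where "Z p \<omega> = \<xi> (fst p) \<omega> * \<xi> (snd p) \<omega>" for p \<omega>
  define C where "C p = c (fst p) * c (snd p)" for p
  have [measurable]: "Z p \<in> borel_measurable M" for p unfolding Z_def by measurable
  have [measurable]: "(\<lambda>\<omega>. cnj (Z p \<omega>)) \<in> borel_measurable M" for p
    by (rule borel_measurable_continuous_on[of cnj]) (auto intro!: continuous_intros)
  have P: "finite ?P" "\<And>p. p \<in> ?P \<Longrightarrow> fst p \<in> B \<and> snd p \<in> B"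
    using B by (auto simp: pairs_with_sum_def intro: finite_subset[of _ "B \<times> B"])
  have iZ: "integrable M (\<lambda>\<omega>. Z p \<omega> * cnj (Z q \<omega>))" if "p \<in> ?P" "q \<in> ?P" for p q
  proof (rule Bochner_Integration.integrable_bound)
    show "integrable M (\<lambda>\<omega>. cmod (\<xi> (fst p) \<omega>) ^ 4 + cmod (\<xi> (snd p) \<omega>) ^ 4 +
        cmod (\<xi> (fst q) \<omega>) ^ 4 + cmod (\<xi> (snd q) \<omega>) ^ 4)"
      using i4 P(2)[OF that(1)] P(2)[OF that(2)] by (intro Bochner_Integration.integrable_add) auto
    show "AE \<omega> in M. cmod (Z p \<omega> * cnj (Z q \<omega>)) \<le> norm (cmod (\<xi> (fst p) \<omega>) ^ 4 + cmod (\<xi> (snd p) \<omega>) ^ 4 +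
        cmod (\<xi> (fst q) \<omega>) ^ 4 + cmod (\<xi> (snd q) \<omega>) ^ 4)"
      unfolding Z_def real_norm_def by (intro AE_I2 order_trans[OF cmod_mult4_le abs_ge_self])
  qed measurable
  have D: "complex_of_real ((cmod (D m \<omega>))\<^sup>2) = (\<Sum>p\<in>?P. \<Sum>q\<in>?P. of_real (C p * C q) * (Z p \<omega> * cnj (Z q \<omega>)))" for \<omega>
  proof -
    have "D m \<omega> = (\<Sum>p\<in>?P. of_real (C p) * Z p \<omega>)"
      unfolding D_def square_coef_def by (intro sum.cong) (simp_all add: C_def Z_def mult_ac)
    then have "complex_of_real ((cmod (D m \<omega>))\<^sup>2) =
        (\<Sum>p\<in>?P. of_real (C p) * Z p \<omega>) * (\<Sum>q\<in>?P. of_real (C q) * cnj (Z q \<omega>))"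
      by (simp only: complex_norm_square cnj_sum complex_cnj_mult complex_cnj_complex_of_real)
    then show ?thesis by (simp add: sum_product mult_ac)
  qed
  have "integrable M (\<lambda>\<omega>. complex_of_real ((cmod (D m \<omega>))\<^sup>2))"
    unfolding D by (intro Bochner_Integration.integrable_sum integrable_mult_right iZ)
  then show "integrable M (\<lambda>\<omega>. (cmod (D m \<omega>))\<^sup>2)" by (simp only: complex_of_real_integrable_eq)
  have K2: "cmod (\<integral>\<omega>. Z p \<omega> * cnj (Z q \<omega>) \<partial>M) \<le> K" if p: "p \<in> ?P" and q: "q = p \<or> q = prod.swap p" for p q
  proof -
    have "Z q = Z p" using q by (auto simp: Z_def mult.commute)
    have "cmod (\<integral>\<omega>. Z p \<omega> * cnj (Z p \<omega>) \<partial>M) \<le> (\<integral>\<omega>. cmod (Z p \<omega> * cnj (Z p \<omega>)) \<partial>M)"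
      by (rule integral_norm_bound)
    also have "\<dots> \<le> (\<integral>\<omega>. (cmod (\<xi> (fst p) \<omega>) ^ 4 + cmod (\<xi> (snd p) \<omega>) ^ 4) / 2 \<partial>M)"
    proof (rule integral_mono)
      show "integrable M (\<lambda>\<omega>. cmod (Z p \<omega> * cnj (Z p \<omega>)))" by (intro integrable_norm iZ p)
      show "integrable M (\<lambda>\<omega>. (cmod (\<xi> (fst p) \<omega>) ^ 4 + cmod (\<xi> (snd p) \<omega>) ^ 4) / 2)"
        using i4 P(2)[OF p] by (intro integrable_divide Bochner_Integration.integrable_add) auto
      show "cmod (Z p \<omega> * cnj (Z p \<omega>)) \<le> (cmod (\<xi> (fst p) \<omega>) ^ 4 + cmod (\<xi> (snd p) \<omega>) ^ 4) / 2" for \<omega>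
        using cmod_mult2_le[of "\<xi> (fst p) \<omega>" "\<xi> (snd p) \<omega>"] by (simp add: Z_def norm_mult power2_eq_square)
    qed
    also have "\<dots> = ((\<integral>\<omega>. cmod (\<xi> (fst p) \<omega>) ^ 4 \<partial>M) + (\<integral>\<omega>. cmod (\<xi> (snd p) \<omega>) ^ 4 \<partial>M)) / 2"
      using i4 P(2)[OF p] by simp
    also have "\<dots> \<le> K" using K[of "fst p"] K[of "snd p"] P(2)[OF p] by simp
    finally show ?thesis using \<open>Z q = Z p\<close> by simp
  qed
  have C: "\<bar>C p * C q\<bar> \<le> s ^ 4" if "p \<in> ?P" "q \<in> ?P" for p q
  proof -
    have "\<bar>C p * C q\<bar> = \<bar>c (fst p)\<bar> * \<bar>c (snd p)\<bar> * (\<bar>c (fst q)\<bar> * \<bar>c (snd q)\<bar>)" by (simp add: C_def abs_mult)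
    also have "\<dots> \<le> s * s * (s * s)"
    proof -
      \<comment> \<open>The hypothesis on \<open>c\<close> forces \<open>s\<close> to be nonnegative
        because the existence of \<open>p\<close> makes \<open>B\<close> nonempty.\<close>
      have "0 \<le> s" using c[of "fst p"] P(2)[OF that(1)] abs_ge_zero[of "c (fst p)"] by linarith
      then show ?thesis
        using c P(2)[OF that(1)] P(2)[OF that(2)] by (intro mult_mono mult_nonneg_nonneg) auto
    qed
    finally show ?thesis by (simp add: power4_eq_xxxx mult.assoc)
  qed
  have inner: "cmod (\<Sum>q\<in>?P. of_real (C p * C q) * (\<integral>\<omega>. Z p \<omega> * cnj (Z q \<omega>) \<partial>M)) \<le> 2 * K * s ^ 4"
    if p: "p \<in> ?P" for p
  proof -
    have K0: "0 \<le> K" using order_trans[OF norm_ge_zero K2[OF p, of p]] by simp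
    have "(\<integral>\<omega>. Z p \<omega> * cnj (Z q \<omega>) \<partial>M) = 0" if q: "q \<in> ?P" "q \<notin> {p, prod.swap p}" for q
    proof -
      \<comment> \<open>Both pairs have sum \<open>m\<close>, so one common entry determines the
        other entry as well.\<close>
      have "{fst p, snd p} \<inter> {fst q, snd q} = {}"
        using p q by (cases p, cases q) (auto simp: pairs_with_sum_def add.commute)
      then show ?thesis unfolding Z_def using P(2)[OF p] P(2)[OF q(1)] by (intro orth) auto
    qed
    then have "(\<Sum>q\<in>?P. of_real (C p * C q) * (\<integral>\<omega>. Z p \<omega> * cnj (Z q \<omega>) \<partial>M))
        = (\<Sum>q\<in>?P \<inter> {p, prod.swap p}. of_real (C p * C q) * (\<integral>\<omega>. Z p \<omega> * cnj (Z q \<omega>) \<partial>M))"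
      using P(1) by (intro sum.mono_neutral_right) auto
    also have "cmod \<dots> \<le> (\<Sum>q\<in>?P \<inter> {p, prod.swap p}. s ^ 4 * K)"
    proof (rule order_trans[OF norm_sum sum_mono])
      fix q assume q: "q \<in> ?P \<inter> {p, prod.swap p}"
      show "cmod (of_real (C p * C q) * (\<integral>\<omega>. Z p \<omega> * cnj (Z q \<omega>) \<partial>M)) \<le> s ^ 4 * K"
        unfolding norm_mult norm_of_real using C[OF p, of q] K2[OF p, of q] q
        by (intro mult_mono) auto
    qed
    also have "\<dots> = card (?P \<inter> {p, prod.swap p}) * (s ^ 4 * K)" by simp
    \<comment> \<open>Two candidates remain, \<open>p\<close> and its swap; they coincide when the
      entries are equal.\<close>
    also have "\<dots> \<le> 2 * (s ^ 4 * K)"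
    proof (rule mult_right_mono)
      have "card (?P \<inter> {p, prod.swap p}) \<le> card {p, prod.swap p}" by (intro card_mono) auto
      also have "\<dots> \<le> 2" by (simp add: card_insert_if)
      finally show "real (card (?P \<inter> {p, prod.swap p})) \<le> 2" by simp
      show "0 \<le> s ^ 4 * K" using K0 by simp
    qed
    finally show ?thesis by (simp add: mult_ac)
  qed
  have "complex_of_real (\<integral>\<omega>. (cmod (D m \<omega>))\<^sup>2 \<partial>M) = (\<integral>\<omega>. complex_of_real ((cmod (D m \<omega>))\<^sup>2) \<partial>M)"
    by (rule integral_complex_of_real[symmetric])
  also have "\<dots> = (\<Sum>p\<in>?P. \<Sum>q\<in>?P. of_real (C p * C q) * (\<integral>\<omega>. Z p \<omega> * cnj (Z q \<omega>) \<partial>M))"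
    unfolding D using iZ by (simp add: Bochner_Integration.integral_sum)
  finally have e: "complex_of_real (\<integral>\<omega>. (cmod (D m \<omega>))\<^sup>2 \<partial>M) =
    (\<Sum>p\<in>?P. \<Sum>q\<in>?P. of_real (C p * C q) * (\<integral>\<omega>. Z p \<omega> * cnj (Z q \<omega>) \<partial>M))" .
  have "(\<integral>\<omega>. (cmod (D m \<omega>))\<^sup>2 \<partial>M) \<le>
      cmod (\<Sum>p\<in>?P. \<Sum>q\<in>?P. of_real (C p * C q) * (\<integral>\<omega>. Z p \<omega> * cnj (Z q \<omega>) \<partial>M))"
    unfolding e[symmetric] by simp
  also have "\<dots> \<le> (\<Sum>p\<in>?P. 2 * K * s ^ 4)" by (intro order_trans[OF norm_sum sum_mono] inner)
  finally show "(\<integral>\<omega>. (cmod (D m \<omega>))\<^sup>2 \<partial>M) \<le> 2 * K * s ^ 4 * card ?P" by (simp add: mult_ac)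
qed

text \<open>The fibres of addition partition \<open>B \<times> B\<close>.\<close>

lemma sum_card_pairs_with_sum:
  assumes "finite B"
  shows "(\<Sum>m\<in>sumset B. card (pairs_with_sum B m)) = (card B)\<^sup>2"
proof -
  have "card (\<Union>m\<in>sumset B. pairs_with_sum B m) = (\<Sum>m\<in>sumset B. card (pairs_with_sum B m))"
    using assms by (intro card_UN_disjoint) (auto simp: sumset_def pairs_with_sum_def)
  moreover have "(\<Union>m\<in>sumset B. pairs_with_sum B m) = B \<times> B"
    by (auto simp: sumset_def pairs_with_sum_def image_iff)
  ultimately show ?thesis by (simp add: card_cartesian_product power2_eq_square)
qed

section \<open>Moments and orthogonality of the white noise coefficients\<close>

definition gaussian_bound :: real where
  "gaussian_bound = 4 * (\<integral>x. normal_density 0 (sqrt (1/2)) x * x ^ 4 \<partial>lborel)"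

lemma normal_power:
  fixes R :: "'w \<Rightarrow> real"
  assumes d: "distributed M lborel R (normal_density 0 \<sigma>)" and \<sigma>: "0 < \<sigma>"
  shows "integrable M (\<lambda>\<omega>. R \<omega> ^ p)"
    and "(\<integral>\<omega>. R \<omega> ^ p \<partial>M) = (\<integral>x. normal_density 0 \<sigma> x * x ^ p \<partial>lborel)"
proof -
  have "integrable lborel (\<lambda>x. normal_density 0 \<sigma> x * x ^ p)"
    using integrable_normal_moment[OF \<sigma>, of 0 p] by simp
  then show "integrable M (\<lambda>\<omega>. R \<omega> ^ p)"
    using distributed_integrable[OF d, of "\<lambda>x. x ^ p"] by simp
  show "(\<integral>\<omega>. R \<omega> ^ p \<partial>M) = (\<integral>x. normal_density 0 \<sigma> x * x ^ p \<partial>lborel)"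
    using distributed_integral[OF d, of "\<lambda>x. x ^ p"] by simp
qed

lemma white_noise_measurable: "white_noise M \<xi> \<Longrightarrow> \<xi> k \<in> borel_measurable M"
  unfolding white_noise_def by blast

text \<open>Real and imaginary parts have the same law, are centered and independent. In the square,
  the difference of their second moments and the mixed term thus vanish; this is the rotational
  symmetry of a complex Gaussian, which the real variable at frequency 0 does not have.\<close>

lemma
  assumes wn: "white_noise M \<xi>" and k: "k \<noteq> 0"
  shows white_noise_integrable_4: "integrable M (\<lambda>\<omega>. cmod (\<xi> k \<omega>) ^ 4)"
    and white_noise_moment_4: "(\<integral>\<omega>. cmod (\<xi> k \<omega>) ^ 4 \<partial>M) \<le> gaussian_bound"
    and white_noise_integrable: "integrable M (\<xi> k)"
    and white_noise_mean: "(\<integral>\<omega>. \<xi> k \<omega> \<partial>M) = 0"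
    and white_noise_square_mean: "(\<integral>\<omega>. \<xi> k \<omega> * \<xi> k \<omega> \<partial>M) = 0"
proof -
  interpret prob_space M using wn by (simp add: white_noise_def)
  note [measurable] = white_noise_measurable[OF wn]
  define R where "R \<omega> = Re (\<xi> k \<omega>)" for \<omega>
  define I where "I \<omega> = Im (\<xi> k \<omega>)" for \<omega>
  define m where "m p = (\<integral>x. normal_density 0 (sqrt (1/2)) x * x ^ p \<partial>lborel)" for p :: nat
  have dR: "distributed M lborel R (normal_density 0 (sqrt (1/2)))"
    and dI: "distributed M lborel I (normal_density 0 (sqrt (1/2)))"
    and ind: "indep_var borel R borel I"
    using wn k unfolding white_noise_def R_def I_def by blast+
  have iR: "integrable M (\<lambda>\<omega>. R \<omega> ^ p)" and mR: "(\<integral>\<omega>. R \<omega> ^ p \<partial>M) = m p" for p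
    using normal_power[OF dR] by (simp_all add: m_def)
  have iI: "integrable M (\<lambda>\<omega>. I \<omega> ^ p)" and mI: "(\<integral>\<omega>. I \<omega> ^ p \<partial>M) = m p" for p
    using normal_power[OF dI] by (simp_all add: m_def)
  have m1: "m 1 = 0"
    using has_bochner_integral_integral_eq[OF normal_moment_odd[of "sqrt (1/2)" 0 0]] by (simp add: m_def)
  have z: "\<xi> k \<omega> = of_real (R \<omega>) + \<i> * of_real (I \<omega>)" for \<omega>
    by (simp add: R_def I_def complex_eq_iff)
  have i1: "integrable M R" "integrable M I" "(\<integral>\<omega>. R \<omega> \<partial>M) = 0" "(\<integral>\<omega>. I \<omega> \<partial>M) = 0"
    using iR[of 1] iI[of 1] mR[of 1] mI[of 1] m1 by simp_all
  have c1: "integrable M (\<lambda>\<omega>. complex_of_real (R \<omega>))" "integrable M (\<lambda>\<omega>. complex_of_real (I \<omega>))"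
    using i1 by (simp_all only: complex_of_real_integrable_eq)
  show "integrable M (\<xi> k)" unfolding z[abs_def] using c1 by (intro Bochner_Integration.integrable_add integrable_mult_right)
  show "(\<integral>\<omega>. \<xi> k \<omega> \<partial>M) = 0"
    unfolding z using c1 i1 by (simp add: integral_complex_of_real)
  have RI: "integrable M (\<lambda>\<omega>. R \<omega> * I \<omega>)" "(\<integral>\<omega>. R \<omega> * I \<omega> \<partial>M) = 0"
    using indep_var_integrable[OF ind i1(1,2)] indep_var_lebesgue_integral[OF ind i1(1,2)] i1 by simp_all
  have z2: "\<xi> k \<omega> * \<xi> k \<omega> = of_real (R \<omega> ^ 2 - I \<omega> ^ 2) + 2 * \<i> * of_real (R \<omega> * I \<omega>)" for \<omega>
    by (simp add: z complex_eq_iff power2_eq_square)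
  have c2: "integrable M (\<lambda>\<omega>. complex_of_real (R \<omega> ^ 2 - I \<omega> ^ 2))" "integrable M (\<lambda>\<omega>. complex_of_real (R \<omega> * I \<omega>))"
    using iR[of 2] iI[of 2] RI by (simp_all only: complex_of_real_integrable_eq Bochner_Integration.integrable_diff)
  have "(\<integral>\<omega>. \<xi> k \<omega> * \<xi> k \<omega> \<partial>M) =
      (\<integral>\<omega>. complex_of_real (R \<omega> ^ 2 - I \<omega> ^ 2) \<partial>M) + 2 * \<i> * (\<integral>\<omega>. complex_of_real (R \<omega> * I \<omega>) \<partial>M)"
    unfolding z2 using c2 by (subst Bochner_Integration.integral_add) (auto simp del: of_real_diff of_real_mult)
  also have "\<dots> = 0"
    unfolding integral_complex_of_real using iR[of 2] iI[of 2] RI by (simp add: mR mI)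
  finally show "(\<integral>\<omega>. \<xi> k \<omega> * \<xi> k \<omega> \<partial>M) = 0" .
  \<comment> \<open>From (a + b)^2 <= 2 a^2 + 2 b^2. The two parts contribute equally in
    expectation, whence the factor 4 in \<open>gaussian_bound\<close>.\<close>
  have p4: "cmod (\<xi> k \<omega>) ^ 4 \<le> 2 * R \<omega> ^ 4 + 2 * I \<omega> ^ 4" for \<omega>
  proof -
    have "cmod (\<xi> k \<omega>) ^ 4 = ((cmod (\<xi> k \<omega>))\<^sup>2)\<^sup>2" by simp
    also have "\<dots> = ((R \<omega>)\<^sup>2 + (I \<omega>)\<^sup>2)\<^sup>2" by (simp only: cmod_power2 R_def I_def)
    also have "\<dots> \<le> 2 * ((R \<omega>)\<^sup>2)\<^sup>2 + 2 * ((I \<omega>)\<^sup>2)\<^sup>2"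
      using sum_squares_bound[of "(R \<omega>)\<^sup>2" "(I \<omega>)\<^sup>2"] by (simp add: power2_sum)
    finally show ?thesis by simp
  qed
  have b: "integrable M (\<lambda>\<omega>. 2 * R \<omega> ^ 4 + 2 * I \<omega> ^ 4)"
    using iR iI by (intro Bochner_Integration.integrable_add integrable_mult_right)
  show i4: "integrable M (\<lambda>\<omega>. cmod (\<xi> k \<omega>) ^ 4)"
  proof (rule Bochner_Integration.integrable_bound[OF b])
    show "AE \<omega> in M. norm (cmod (\<xi> k \<omega>) ^ 4) \<le> norm (2 * R \<omega> ^ 4 + 2 * I \<omega> ^ 4)"
      using p4 by (intro AE_I2) (simp add: order_trans[OF _ abs_ge_self])
  qed measurable
  have "(\<integral>\<omega>. cmod (\<xi> k \<omega>) ^ 4 \<partial>M) \<le> (\<integral>\<omega>. 2 * R \<omega> ^ 4 + 2 * I \<omega> ^ 4 \<partial>M)"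
    using i4 b p4 by (rule integral_mono)
  also have "\<dots> = gaussian_bound"
    using iR[of 4] iI[of 4] by (simp add: mR mI gaussian_bound_def m_def)
  finally show "(\<integral>\<omega>. cmod (\<xi> k \<omega>) ^ 4 \<partial>M) \<le> gaussian_bound" .
qed

text \<open>Distinct indices in the half lattice are independent and centered, and equal ones use
  the vanishing square mean. The half lattice excludes l = -k, where the expectation would be that
  of |\<xi>_k|^2.\<close>

lemma white_noise_pair_mean:
  assumes wn: "white_noise M \<xi>" and k: "k \<in> half_lattice" "k \<noteq> 0" "l \<in> half_lattice" "l \<noteq> 0"
  shows "(\<integral>\<omega>. \<xi> k \<omega> * \<xi> l \<omega> \<partial>M) = 0"
proof (cases "k = l")
  case True
  then show ?thesis using white_noise_square_mean[OF wn k(2)] by simp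
next
  case False
  interpret prob_space M using wn by (simp add: white_noise_def)
  have "indep_vars (\<lambda>_. borel) \<xi> {k, l}"
    using wn k by (auto simp: white_noise_def intro: indep_vars_subset)
  then have "(\<integral>\<omega>. (\<Prod>j\<in>{k, l}. \<xi> j \<omega>) \<partial>M) = (\<Prod>j\<in>{k, l}. \<integral>\<omega>. \<xi> j \<omega> \<partial>M)"
    by (intro indep_vars_lebesgue_integral) (use white_noise_integrable[OF wn] k in auto)
  then show ?thesis using False white_noise_mean[OF wn k(2)] by simp
qed

text \<open>Products over disjoint index sets are independent, so the expectation factorizes, and
  the factor of the first pair is zero. Repeated indices within a pair are allowed.\<close>

lemma white_noise_pairs_orthogonal:
  assumes wn: "white_noise M \<xi>"
    and k: "{k, l, k', l'} \<subseteq> half_lattice - {0}" and dis: "{k, l} \<inter> {k', l'} = {}"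
  shows "(\<integral>\<omega>. \<xi> k \<omega> * \<xi> l \<omega> * cnj (\<xi> k' \<omega> * \<xi> l' \<omega>) \<partial>M) = 0"
proof -
  interpret prob_space M using wn by (simp add: white_noise_def)
  note [measurable] = white_noise_measurable[OF wn]
  have [measurable]: "cnj \<in> borel_measurable borel"
    by (intro borel_measurable_continuous_onI continuous_intros)
  have ii: "integrable M (\<lambda>\<omega>. \<xi> j \<omega> * \<xi> i \<omega>)" if "j \<noteq> 0" "i \<noteq> 0" for j i
  proof (rule Bochner_Integration.integrable_bound)
    show "integrable M (\<lambda>\<omega>. 1 + (cmod (\<xi> j \<omega>) ^ 4 + cmod (\<xi> i \<omega>) ^ 4))"
      using white_noise_integrable_4[OF wn] that by simp
    show "AE \<omega> in M. cmod (\<xi> j \<omega> * \<xi> i \<omega>) \<le> norm (1 + (cmod (\<xi> j \<omega>) ^ 4 + cmod (\<xi> i \<omega>) ^ 4))"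
    proof (rule AE_I2)
      fix \<omega>
      have "2 * cmod (\<xi> j \<omega> * \<xi> i \<omega>) \<le> (cmod (\<xi> j \<omega>))\<^sup>2 + (cmod (\<xi> i \<omega>))\<^sup>2"
        using sum_squares_bound[of "cmod (\<xi> j \<omega>)" "cmod (\<xi> i \<omega>)"] by (simp add: norm_mult)
      moreover have "(cmod y)\<^sup>2 \<le> 1 + cmod y ^ 4" for y
      proof -
        have "2 * (cmod y)\<^sup>2 \<le> cmod y ^ 4 + 1" using sum_squares_bound[of "(cmod y)\<^sup>2" 1] by simp
        moreover have "0 \<le> cmod y ^ 4" by simp
        ultimately show ?thesis by linarith
      qed
      note this[of "\<xi> j \<omega>"] this[of "\<xi> i \<omega>"]
      moreover have "0 \<le> cmod (\<xi> j \<omega>) ^ 4" "0 \<le> cmod (\<xi> i \<omega>) ^ 4" by simp_all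
      ultimately have "cmod (\<xi> j \<omega> * \<xi> i \<omega>) \<le> 1 + (cmod (\<xi> j \<omega>) ^ 4 + cmod (\<xi> i \<omega>) ^ 4)"
        by linarith
      then show "cmod (\<xi> j \<omega> * \<xi> i \<omega>) \<le> norm (1 + (cmod (\<xi> j \<omega>) ^ 4 + cmod (\<xi> i \<omega>) ^ 4))" by simp
    qed
  qed measurable
  have "indep_vars (\<lambda>_. borel) \<xi> half_lattice" using wn by (simp add: white_noise_def)
  \<comment> \<open>The family restricted to two disjoint index sets gives two independent random
    vectors, of which the products are measurable functions.\<close>
  then have "indep_var (PiM {k, l} (\<lambda>_. borel)) (\<lambda>\<omega>. restrict (\<lambda>i. \<xi> i \<omega>) {k, l})
      (PiM {k', l'} (\<lambda>_. borel)) (\<lambda>\<omega>. restrict (\<lambda>i. \<xi> i \<omega>) {k', l'})"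
    using dis k by (intro indep_var_restrict) auto
  from indep_var_compose[OF this, of "\<lambda>f. f k * f l" borel "\<lambda>f. cnj (f k' * f l')" borel]
  have "indep_var borel (\<lambda>\<omega>. \<xi> k \<omega> * \<xi> l \<omega>) borel (\<lambda>\<omega>. cnj (\<xi> k' \<omega> * \<xi> l' \<omega>))"
    by (simp add: comp_def)
  moreover have "integrable M (\<lambda>\<omega>. \<xi> k \<omega> * \<xi> l \<omega>)" using k by (intro ii) auto
  moreover have "integrable M (\<lambda>\<omega>. cnj (\<xi> k' \<omega> * \<xi> l' \<omega>))"
    using k by (intro integrable_bounded_linear[OF bounded_linear_cnj] ii) auto
  ultimately have "(\<integral>\<omega>. \<xi> k \<omega> * \<xi> l \<omega> * cnj (\<xi> k' \<omega> * \<xi> l' \<omega>) \<partial>M) =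
      (\<integral>\<omega>. \<xi> k \<omega> * \<xi> l \<omega> \<partial>M) * (\<integral>\<omega>. cnj (\<xi> k' \<omega> * \<xi> l' \<omega>) \<partial>M)"
    by (rule indep_var_lebesgue_integral)
  then show ?thesis using white_noise_pair_mean[OF wn, of k l] k by simp
qed

section \<open>Energy of the dyadic blocks\<close>

lemma card_sumset_dyadic_block: "card (sumset (dyadic_block n)) \<le> 4 ^ (n + 3)"
proof -
  have "sumset (dyadic_block n) \<subseteq> {- (2 ^ (n + 2))..<2 ^ (n + 2)} \<times> {- (2 ^ (n + 2))..<2 ^ (n + 2)}"
  proof
    fix m assume "m \<in> sumset (dyadic_block n)"
    then obtain k l where m: "m = k + l" "k \<in> dyadic_block n" "l \<in> dyadic_block n"
      by (auto simp: sumset_def)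
    then have "fst k \<in> {- (2 ^ (n + 1))..<2 ^ (n + 1)}" "snd k \<in> {- (2 ^ (n + 1))..<2 ^ (n + 1)}"
      "fst l \<in> {- (2 ^ (n + 1))..<2 ^ (n + 1)}" "snd l \<in> {- (2 ^ (n + 1))..<2 ^ (n + 1)}"
      using dyadic_block_subset[of n] by (auto simp: mem_Times_iff)
    then show "m \<in> {- (2 ^ (n + 2))..<2 ^ (n + 2)} \<times> {- (2 ^ (n + 2))..<2 ^ (n + 2)}"
      by (simp add: m(1) mem_Times_iff)
  qed
  from card_mono[OF _ this] card_square[of "n + 2"] show ?thesis by (simp add: numeral_eq_Suc)
qed

lemma gaussian_bound_nonneg: "0 \<le> gaussian_bound"
  by (simp add: gaussian_bound_def)

text \<open>By Parseval this is the integral over the torus of the fourth power of the modulus of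
  the n-th block of X.\<close>

definition block_energy :: "(freq \<Rightarrow> 'w \<Rightarrow> complex) \<Rightarrow> nat \<Rightarrow> 'w \<Rightarrow> real" where
  "block_energy \<xi> n \<omega> = (\<Sum>m\<in>sumset (dyadic_block n). (cmod (square_coef (dyadic_block n) (X_coef \<xi> \<omega>) m))\<^sup>2)"

lemma block_energy_nonneg: "0 \<le> block_energy \<xi> n \<omega>"
  by (simp add: block_energy_def sum_nonneg)

text \<open>The multipliers of the block are at most \<open>4 ^ n\<close> in inverse size, and the
  numbers of pairs add up over all m to the squared cardinality of the block, which is of order
  \<open>16 ^ n\<close>.\<close>

lemma
  assumes wn: "white_noise M \<xi>"
  shows integrable_block_energy: "integrable M (block_energy \<xi> n)"
    and expectation_block_energy: "(\<integral>\<omega>. block_energy \<xi> n \<omega> \<partial>M) \<le> 512 * gaussian_bound / 16 ^ n"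
proof -
  interpret prob_space M using wn by (simp add: white_noise_def)
  let ?B = "dyadic_block n"
  define c where "c k = - inverse ((norm (kvec k))\<^sup>2)" for k
  have nz: "k \<noteq> 0" "k \<in> half_lattice" if "k \<in> ?B" for k using that by (auto simp: dyadic_block_def)
  have eq: "square_coef ?B (X_coef \<xi> \<omega>) m = square_coef ?B (\<lambda>k. of_real (c k) * \<xi> k \<omega>) m" for \<omega> m
    unfolding square_coef_def
    by (intro sum.cong) (auto simp: pairs_with_sum_def X_coef_def c_def divide_inverse nz mult_ac)
  have c: "\<bar>c k\<bar> \<le> 1 / 4 ^ n" if "k \<in> ?B" for k
  proof -
    have "inverse ((norm (kvec k))\<^sup>2) \<le> inverse (4 ^ n)"
      using norm_kvec_dyadic_block[OF that] by (intro le_imp_inverse_le) auto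
    then show ?thesis by (simp add: c_def inverse_eq_divide)
  qed
  note est = expectation_square_coef_le[where \<xi>=\<xi> and c=c and B="?B" and K=gaussian_bound and s="1 / 4 ^ n",
      OF finite_dyadic_block white_noise_measurable[OF wn] white_noise_integrable_4[OF wn nz(1)]
        white_noise_moment_4[OF wn nz(1)] c white_noise_pairs_orthogonal[OF wn], folded eq]
  have i: "integrable M (\<lambda>\<omega>. (cmod (square_coef ?B (X_coef \<xi> \<omega>) m))\<^sup>2)" for m
    by (rule est(1)) (use nz in auto)
  have e: "(\<integral>\<omega>. (cmod (square_coef ?B (X_coef \<xi> \<omega>) m))\<^sup>2 \<partial>M)
      \<le> 2 * gaussian_bound * (1 / 4 ^ n) ^ 4 * card (pairs_with_sum ?B m)" for m
    by (rule est(2)) (use nz in auto)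
  show "integrable M (block_energy \<xi> n)"
    unfolding block_energy_def[abs_def] using i by (rule Bochner_Integration.integrable_sum)
  have "(\<integral>\<omega>. block_energy \<xi> n \<omega> \<partial>M) = (\<Sum>m\<in>sumset ?B. \<integral>\<omega>. (cmod (square_coef ?B (X_coef \<xi> \<omega>) m))\<^sup>2 \<partial>M)"
    unfolding block_energy_def using i by (rule Bochner_Integration.integral_sum)
  also have "\<dots> \<le> (\<Sum>m\<in>sumset ?B. 2 * gaussian_bound * (1 / 4 ^ n) ^ 4 * card (pairs_with_sum ?B m))"
    by (intro sum_mono e)
  also have "\<dots> = 2 * gaussian_bound * (1 / 4 ^ n) ^ 4 * real ((card ?B)\<^sup>2)"
    unfolding sum_card_pairs_with_sum[OF finite_dyadic_block, symmetric] by (simp add: sum_distrib_left)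
  also have "\<dots> \<le> 2 * gaussian_bound * (1 / 4 ^ n) ^ 4 * (4 ^ (n + 2))\<^sup>2"
  proof (rule mult_left_mono)
    have "real (card ?B) \<le> 4 ^ (n + 2)" using card_dyadic_block[of n] by (metis of_nat_le_iff of_nat_numeral of_nat_power)
    then show "real ((card ?B)\<^sup>2) \<le> (4 ^ (n + 2))\<^sup>2" by (simp only: of_nat_power) (rule power_mono, simp_all)
  qed (simp add: gaussian_bound_nonneg)
  \<comment> \<open>The fourth power of the multiplier bound contributes
    \<open>16 ^ n * 16 ^ n\<close> in the denominator, the count \<open>256 * 16 ^ n\<close> in the
    numerator, and 512 = 2 * 256.\<close>
  also have "\<dots> = 512 * gaussian_bound / 16 ^ n"
  proof -
    have "(4 ^ n) ^ 4 = (16 ^ n * 16 ^ n :: real)" "(4 ^ (n + 2))\<^sup>2 = (256 * 16 ^ n :: real)"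
      by (simp_all add: power_add power_mult_distrib power2_eq_square power4_eq_xxxx flip: power_mult_distrib)
    then show ?thesis by (simp add: power_one_over power_divide)
  qed
  finally show "(\<integral>\<omega>. block_energy \<xi> n \<omega> \<partial>M) \<le> 512 * gaussian_bound / 16 ^ n" .
qed

text \<open>A Borel-Cantelli type argument: the expectations of suitably weighted energies are
  summable, so almost surely the energies have a finite sum, and this sum bounds each of
  them.\<close>

lemma AE_trig_sum_bound:
  assumes wn: "white_noise M \<xi>"
  shows "AE \<omega> in M. \<exists>L\<ge>0. \<forall>n x. (cmod (trig_sum (dyadic_block n) (X_coef \<xi> \<omega>) x)) ^ 4 \<le> L * (1/2) ^ n"
proof -
  \<comment> \<open>\<open>4 ^ (n + 3)\<close> bounds the number of frequencies in the squared
    block; \<open>2 ^ n\<close> is the decay kept for the conclusion.\<close>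
  define V where "V n \<omega> = 2 ^ n * 4 ^ (n + 3) * block_energy \<xi> n \<omega>" for n \<omega>
  \<comment> \<open>32768 = 64 * 512, with 64 coming from \<open>4 ^ 3\<close>; the powers combine
    to 8^n / 16^n.\<close>
  define C where "C = 32768 * gaussian_bound"
  have V0: "0 \<le> V n \<omega>" for n \<omega> by (simp add: V_def block_energy_nonneg)
  have iV: "integrable M (V n)" for n
    unfolding V_def[abs_def] using integrable_block_energy[OF wn] by (rule integrable_mult_right)
  then have [measurable]: "V n \<in> borel_measurable M" for n by (rule borel_measurable_integrable)
  have eV: "(\<integral>\<omega>. V n \<omega> \<partial>M) \<le> C * (1/2) ^ n" for n
  proof -
    have "(\<integral>\<omega>. V n \<omega> \<partial>M) \<le> 2 ^ n * 4 ^ (n + 3) * (512 * gaussian_bound / 16 ^ n)"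
      unfolding V_def integral_mult_right_zero
      by (intro mult_left_mono expectation_block_energy[OF wn]) simp
    also have "\<dots> = C * (1/2) ^ n"
    proof -
      have "(16 ^ n :: real) = 2 ^ n * (2 ^ n * 4 ^ n)" by (simp flip: power_mult_distrib)
      then show ?thesis by (simp add: C_def power_add power_one_over divide_simps)
    qed
    finally show ?thesis .
  qed
  \<comment> \<open>Tonelli: the random series has finite expectation, hence is finite almost
    surely.\<close>
  have "(\<integral>\<^sup>+\<omega>. (\<Sum>n. ennreal (V n \<omega>)) \<partial>M) = (\<Sum>n. \<integral>\<^sup>+\<omega>. ennreal (V n \<omega>) \<partial>M)"
    by (rule nn_integral_suminf) simp
  also have "\<dots> \<le> (\<Sum>n. ennreal (C * (1/2) ^ n))"
    by (intro suminf_le summableI) (simp add: nn_integral_eq_integral[OF iV] V0 eV ennreal_leI)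
  also have "\<dots> < \<infinity>"
  proof -
    have "summable (\<lambda>n. C * (1/2 :: real) ^ n)" by (intro summable_mult summable_geometric) simp
    then have "(\<Sum>n. ennreal (C * (1/2) ^ n)) = ennreal (\<Sum>n. C * (1/2) ^ n)"
      by (intro suminf_ennreal2) (auto simp: C_def gaussian_bound_nonneg)
    then show ?thesis by simp
  qed
  finally have "AE \<omega> in M. (\<Sum>n. ennreal (V n \<omega>)) \<noteq> \<infinity>"
    by (intro nn_integral_PInf_AE) auto
  then show ?thesis
  proof eventually_elim
    case (elim \<omega>)
    define L where "L = enn2real (\<Sum>n. ennreal (V n \<omega>))"
    have L: "ennreal L = (\<Sum>n. ennreal (V n \<omega>))" using elim by (simp add: L_def less_top)
    have L0: "0 \<le> L" by (simp add: L_def)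
    have VL: "V n \<omega> \<le> L" for n
    proof -
      have "ennreal (V n \<omega>) \<le> ennreal L"
        unfolding L using sum_le_suminf[of "\<lambda>n. ennreal (V n \<omega>)" "{n}"] by (simp add: summableI)
      then show ?thesis using L0 by (simp add: ennreal_le_iff)
    qed
    have "(cmod (trig_sum (dyadic_block n) (X_coef \<xi> \<omega>) x)) ^ 4 \<le> L * (1/2) ^ n" for n x
    proof -
      have "(cmod (trig_sum (dyadic_block n) (X_coef \<xi> \<omega>) x)) ^ 4 \<le> card (sumset (dyadic_block n)) * block_energy \<xi> n \<omega>"
        unfolding block_energy_def by (rule trig_sum_power4_le) simp
      also have "\<dots> \<le> 4 ^ (n + 3) * block_energy \<xi> n \<omega>"
      proof (rule mult_right_mono[OF _ block_energy_nonneg])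
        show "real (card (sumset (dyadic_block n))) \<le> 4 ^ (n + 3)"
          using card_sumset_dyadic_block[of n] by (metis of_nat_le_iff of_nat_numeral of_nat_power)
      qed
      also have "\<dots> = V n \<omega> * (1/2) ^ n" by (simp add: V_def power_one_over)
      also have "\<dots> \<le> L * (1/2) ^ n" by (intro mult_right_mono VL) simp
      finally show ?thesis .
    qed
    with L0 show ?case by blast
  qed
qed

section \<open>Almost sure continuity of X\<close>

lemma AE_X_coef_cnj:
  assumes wn: "white_noise M \<xi>"
  shows "AE \<omega> in M. \<forall>k. X_coef \<xi> \<omega> (- k) = cnj (X_coef \<xi> \<omega> k)"
proof -
  have "AE \<omega> in M. \<forall>k. \<xi> (- k) \<omega> = cnj (\<xi> k \<omega>)"
    \<comment> \<open>There are countably many frequencies, so the exceptional null sets can be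
      united.\<close>
    unfolding AE_all_countable using wn unfolding white_noise_def by blast
  then show ?thesis
    by eventually_elim (simp add: X_coef_def kvec_minus del: split_paired_All)
qed

text \<open>The description in \<open>X_field\<close> denotes the intended function once existence
  and uniqueness hold; existence comes from the summable block bounds, uniqueness from the Fourier
  coefficients.\<close>

lemma AE_X_field_continuous:
  assumes wn: "white_noise M \<xi>"
  shows "AE \<omega> in M. continuous_on UNIV (X_field \<xi> \<omega>) \<and> doubly_periodic (X_field \<xi> \<omega>)"
  using AE_trig_sum_bound[OF wn] AE_X_coef_cnj[OF wn]
proof eventually_elim
  case (elim \<omega>)
  then obtain L where L: "0 \<le> L"
    "\<And>n x. (cmod (trig_sum (dyadic_block n) (X_coef \<xi> \<omega>) x)) ^ 4 \<le> L * (1/2) ^ n" by blast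
  have "\<exists>f. continuous_on UNIV f \<and> doubly_periodic f \<and> (\<forall>k. fcoef f k = X_coef \<xi> \<omega> k)"
  proof (rule continuous_function_of_blocks)
    show "X_coef \<xi> \<omega> 0 = 0" by (simp add: X_coef_def)
    show "X_coef \<xi> \<omega> (- k) = cnj (X_coef \<xi> \<omega> k)" for k using elim(2) by blast
    \<comment> \<open>Fourth roots of the bounds \<open>L * (1/2) ^ n\<close> form a geometric
      series with ratio \<open>root 4 (1/2)\<close>, which is less than 1.\<close>
    show "summable (\<lambda>n. root 4 L * root 4 (1/2) ^ n)"
      by (intro summable_mult summable_geometric) simp
    show "cmod (trig_sum (dyadic_block n) (X_coef \<xi> \<omega>) x) \<le> root 4 L * root 4 (1/2) ^ n" for n x
    proof -
      have "cmod (trig_sum (dyadic_block n) (X_coef \<xi> \<omega>) x) = root 4 (cmod (trig_sum (dyadic_block n) (X_coef \<xi> \<omega>) x) ^ 4)"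
        by (simp add: real_root_power_cancel)
      also have "\<dots> \<le> root 4 (L * (1/2) ^ n)" using L(2) by simp
      also have "\<dots> = root 4 L * root 4 (1/2) ^ n"
        by (simp only: real_root_mult) (simp add: real_root_power)
      finally show ?thesis .
    qed
  qed
  then have "\<exists>!f. continuous_on UNIV f \<and> doubly_periodic f \<and> (\<forall>k. fcoef f k = X_coef \<xi> \<omega> k)"
    by (rule ex_ex1I) (metis continuous_periodic_fcoef_unique)
  from theI'[OF this] show ?case unfolding X_field_def by blast
qed

theorem proposition2p3:
  fixes M :: "'w measure"
    and \<xi> :: "int \<times> int \<Rightarrow> 'w \<Rightarrow> complex"
    and \<rho> \<theta> \<phi> :: "real \<times> real \<Rightarrow> real"
  assumes "white_noise M \<xi>"
    and "mollifier \<rho>"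
    and "littlewood_paley \<theta> \<phi>"
  shows "AE \<omega> in M. closed_form (anderson_form M \<xi> \<rho> \<theta> \<phi> \<omega>)"
  using AE_X_field_continuous[OF assms(1)]
  by eventually_elim (simp add: closed_form_anderson)

end
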